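(* Let $R$ be a unital commutative ring and $M$ an $R$-module. (1) Let $S$ be the set of maximal ideals $\mathfrak{m}$ of $R$ for which $\dim_{R/\mathfrak{m}} M/\mathfrak{m}M \geq 2$, and define the cardinal number $$\nu'(R,M) := \min_{\mathfrak{m} \in S} |R/\mathfrak{m}|+1$$ (when $S$ is nonempty). If $S$ is nonempty, then $\sigma(M) \leq \nu'(R,M)$ as cardinal numbers. (2) $M$ admits a finite covering by proper $R$-submodules if and only if $M$ has a finite non-cyclic quotient $R$-module. Moreover, every irredundant finite covering of $M$ by proper $R$-submodules is induced by lifting a covering of a finite quotient $R$-module of $M$. (3) If $M$ admits a finite covering by proper $R$-submodules, then (the set $S$ is nonempty, so that $\nu'(R,M)$ is defined, and) $\sigma(M) = \nu'(R,M)$.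
   Context: A covering of an $R$-module $M$ is a family of proper $R$-submodules whose union is $M$; it is finite if the family is finite, and irredundant if no proper subfamily has union $M$. The covering number $\sigma(M)$ is the smallest cardinal $\aleph$ (possibly infinite) such that $M$ is a union of $\aleph$-many proper $R$-submodules; it is defined when $M$ has some covering by proper submodules (an upper bound on $\sigma(M)$ includes the assertion that a covering exists). A quotient is finite if its underlying set is finite; a module is cyclic if it is generated by one element. A covering of $M$ is induced by lifting a covering of a quotient $\pi : M \to Q$ if it has the form $\{\pi^{-1}(N_i)\}$ where $\{N_i\}$ is a covering of $Q$ by proper submodules. The expression $\min_{\mathfrak{m}\in S}|R/\mathfrak{m}|+1$ means the minimum over $\mathfrak{m}\in S$ of the cardinal $|R/\mathfrak{m}|+1$. *)

theory Defs
  imports "HOL-Algebra.QuotRing" "Jordan_Normal_Form.Missing_VectorSpace"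
begin

unbundle cardinal_syntax

text \<open>The fields \<open>mult\<close> and \<open>one\<close> that a module record inherits from the ring record carry no
  meaning for a module; in the records below they are filled arbitrarily.\<close>

definition quot_module :: "('a, 'b, 'd) module_scheme \<Rightarrow> 'b set \<Rightarrow> ('a, 'b set) module"
  where "quot_module M N =
    \<lparr>carrier = a_rcosets\<^bsub>M\<^esub> N, mult = (\<lambda>_ _. N), one = N, zero = N, add = set_add M,
     smult = (\<lambda>r X. \<Union>x\<in>X. N +>\<^bsub>M\<^esub> (r \<odot>\<^bsub>M\<^esub> x))\<rparr>"

definition ideal_smult :: "('a, 'c) ring_scheme \<Rightarrow> ('a, 'b, 'd) module_scheme \<Rightarrow> 'a set \<Rightarrow> 'b set"
  where "ideal_smult R M I = module.span R M {a \<odot>\<^bsub>M\<^esub> x | a x. a \<in> I \<and> x \<in> carrier M}"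

text \<open>\<open>M / I M\<close> with its structure of a module over \<open>R Quot I\<close>: \<open>(a + I) (x + I M) = a x + I M\<close>.\<close>

definition reduction :: "('a, 'c) ring_scheme \<Rightarrow> ('a, 'b, 'd) module_scheme \<Rightarrow> 'a set
    \<Rightarrow> ('a set, 'b set) module"
  where "reduction R M I =
    (let N = ideal_smult R M I in
    \<lparr>carrier = a_rcosets\<^bsub>M\<^esub> N, mult = (\<lambda>_ _. N), one = N, zero = N, add = set_add M,
     smult = (\<lambda>A X. \<Union>a\<in>A. \<Union>x\<in>X. N +>\<^bsub>M\<^esub> (a \<odot>\<^bsub>M\<^esub> x))\<rparr>)"

definition cyclic_module :: "('a, 'c) ring_scheme \<Rightarrow> ('a, 'b, 'd) module_scheme \<Rightarrow> bool"
  where "cyclic_module R M \<longleftrightarrow> (\<exists>x\<in>carrier M. module.span R M {x} = carrier M)"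

text \<open>Coverings are sets of submodules rather than indexed families. Repeated members of a family
  change neither the existence of (finite) coverings nor the least cardinality of a covering,
  and an irredundant family has no repeated members.\<close>

definition covering :: "('a, 'c) ring_scheme \<Rightarrow> ('a, 'b, 'd) module_scheme \<Rightarrow> 'b set set \<Rightarrow> bool"
  where "covering R M C \<longleftrightarrow>
    (\<forall>N\<in>C. submodule R N M \<and> N \<noteq> carrier M) \<and> \<Union>C = carrier M"

definition irredundant :: "('b, 'd) partial_object_scheme \<Rightarrow> 'b set set \<Rightarrow> bool"
  where "irredundant M C \<longleftrightarrow> (\<forall>D. D \<subset> C \<longrightarrow> \<Union>D \<noteq> carrier M)"

definition lifted_covering :: "('a, 'b, 'd) module_scheme \<Rightarrow> 'b set \<Rightarrow> 'b set set set \<Rightarrow> 'b set set"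
  where "lifted_covering M N D = (\<lambda>L. {x \<in> carrier M. N +>\<^bsub>M\<^esub> x \<in> L}) ` D"

text \<open>Cardinals are represented by cardinal orders, which are compared by \<open>\<le>o\<close> and identified up to
  \<open>=o\<close>. The following picks a representative of the least element of a set of cardinals; it is
  unspecified for the empty set.\<close>

definition min_cardinal :: "'x rel set \<Rightarrow> 'x rel"
  where "min_cardinal K = (SOME r. r \<in> K \<and> (\<forall>s\<in>K. r \<le>o s))"

definition covering_number ::
    "('a, 'c) ring_scheme \<Rightarrow> ('a, 'b, 'd) module_scheme \<Rightarrow> 'b set rel"
  where "covering_number R M = min_cardinal {|C| | C. covering R M C}"

text \<open>The library's \<open>dim\<close> is a natural number that is meaningful only for finite-dimensional spaces,
  so the infinite-dimensional case is listed separately.\<close>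

definition large_fibres :: "('a, 'c) ring_scheme \<Rightarrow> ('a, 'b, 'd) module_scheme \<Rightarrow> 'a set set"
  where "large_fibres R M = {I. maximalideal I R \<and>
    (\<not> vectorspace.fin_dim (R Quot I) (reduction R M I) \<or>
     vectorspace.dim (R Quot I) (reduction R M I) \<ge> 2)}"

definition nu' :: "('a, 'c) ring_scheme \<Rightarrow> ('a, 'b, 'd) module_scheme \<Rightarrow> ('a set + unit) rel"
  where "nu' R M = min_cardinal {|carrier (R Quot I)| +c cone | I. I \<in> large_fibres R M}"

end

theory Submission
  imports Defs
begin

text \<open>
  Write \<open>k = R/\<mm>\<close> for a maximal ideal \<open>\<mm>\<close>. If \<open>M/\<mm>M\<close> has dimension at least two over \<open>k\<close>, then \<open>M\<close>
  maps onto the plane \<open>k\<^sup>2\<close>, which is the union of its lines through the origin; there are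
  \<open>\<bar>k\<bar> + 1\<close> of them, and their preimages cover \<open>M\<close> (\<open>exists_covering_by_lines\<close>). This is the upper
  bound. The plane is obtained by choosing, with Zorn's lemma, a hyperplane \<open>H \<supseteq> \<mm>M\<close> of \<open>M\<close> that
  avoids some \<open>x\<close>, and a hyperplane \<open>W \<supseteq> \<mm>M\<close> of \<open>H\<close> that avoids some \<open>y\<close>; so \<open>M/W\<close> has basis
  \<open>x\<close>, \<open>y\<close>, and neither functionals nor bases of \<open>M/\<mm>M\<close> are involved.

  Finite coverings are governed by B. H. Neumann's theorem: the members of an irredundant finite
  covering of a group by subgroups have finite index
  (\<open>finite_index_if_irredundant_cover\<close>). Hence the intersection \<open>N\<close> of such a covering of \<open>M\<close> has
  finite index, and the covering is lifted from the finite module \<open>M/N\<close>. This quotient is not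
  cyclic, because a generator would lie in a proper submodule. Conversely, a finite quotient that is
  not cyclic is covered by its finitely many cyclic submodules.

  For the lower bound, take any finite covering with \<open>n\<close> members and make it irredundant. Its
  members have finite index, so each lies in a maximal submodule; these maximal submodules cover
  \<open>M\<close>, and again some of them form an irredundant covering. For a maximal submodule \<open>L\<close> the annihilator of
  \<open>M/L\<close> is a maximal ideal, and an idempotent modulo these ideals shows that all
  members of the covering share a single one, \<open>\<mm>\<close> (\<open>quotient_annihilators_agree\<close>). No member
  being all of \<open>M\<close>, the space \<open>M/\<mm>M\<close> is not generated by one element. Finally, if \<open>x\<close> lies in the
  member \<open>L\<close> only and \<open>y\<close> lies outside \<open>L\<close>, then the vectors \<open>y + c x\<close>, with \<open>c\<close> running over
  representatives of \<open>k\<close>, all avoid \<open>L\<close>, and no two of them lie in the same member. Therefore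
  \<open>n \<ge> \<bar>k\<bar> + 1\<close> (\<open>irredundant_maximal_covering_bound\<close>).
\<close>

section \<open>Finite coverings of an abelian group by cosets\<close>

context abelian_group
begin

lemma mem_a_r_coset_iff:
  assumes "additive_subgroup H G" "x \<in> carrier G" "t \<in> carrier G"
  shows "x \<in> H +> t \<longleftrightarrow> x \<ominus> t \<in> H"
  using abelian_subgroup.a_rcos_module[OF abelian_subgroupI3[OF assms(1) abelian_group_axioms] assms(3,2)]
  by (simp add: a_minus_def)

lemma a_r_coset_eq_iff:
  assumes "additive_subgroup H G" "x \<in> carrier G" "t \<in> carrier G"
  shows "H +> x = H +> t \<longleftrightarrow> x \<ominus> t \<in> H"
proof
  interpret abelian_subgroup H G
    by (rule abelian_subgroupI3[OF assms(1) abelian_group_axioms])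
  show "x \<ominus> t \<in> H" if "H +> x = H +> t"
    using a_rcos_self[OF assms(2)] that mem_a_r_coset_iff[OF assms] by simp
  show "H +> x = H +> t" if "x \<ominus> t \<in> H"
    using that mem_a_r_coset_iff[OF assms] a_repr_independence'[OF _ assms(3)] by metis
qed

lemma finite_index_if_cover_by_cosets:
  assumes H: "additive_subgroup H G" and T: "finite T" "T \<subseteq> carrier G"
    and cover: "carrier G \<subseteq> (\<Union>t\<in>T. H +> t)"
  shows "finite (a_rcosets H)"
proof (rule finite_subset)
  show "a_rcosets H \<subseteq> (\<lambda>t. H +> t) ` T"
  proof
    fix X assume "X \<in> a_rcosets H"
    then obtain x where x: "x \<in> carrier G" "X = H +> x"
      by (auto simp: A_RCOSETS_def')
    then obtain t where t: "t \<in> T" "x \<in> H +> t"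
      using cover by blast
    then have "X = H +> t"
      using x T(2) H mem_a_r_coset_iff a_r_coset_eq_iff by blast
    with t show "X \<in> (\<lambda>t. H +> t) ` T" by blast
  qed
qed (use T in simp)

text \<open>
  Induction on the number of subgroups. If the cosets of one subgroup \<open>H\<close> do not already cover \<open>G\<close>,
  then some coset of \<open>H\<close> is disjoint from all those in the covering and is thus covered by cosets of
  the other subgroups. Translating that covering handles every coset of \<open>H\<close>, so that \<open>H\<close> can be
  dispensed with at the price of a larger, but still finite, set of translations. A single finite
  set \<open>T\<close> of translations for all subgroups keeps the bookkeeping of the induction light.
\<close>

lemma exists_finite_index_in_coset_cover:
  assumes "finite HH" "\<forall>H\<in>HH. additive_subgroup H G" "finite T" "T \<subseteq> carrier G"
    and "carrier G \<subseteq> (\<Union>H\<in>HH. \<Union>t\<in>T. H +> t)"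
  shows "\<exists>H\<in>HH. finite (a_rcosets H)"
  using assms
proof (induction HH arbitrary: T rule: finite_induct)
  case empty
  then show ?case using zero_closed by auto
next
  case (insert H HH)
  have H: "additive_subgroup H G" using insert.prems by simp
  show ?case
  proof (cases "carrier G \<subseteq> (\<Union>t\<in>T. H +> t)")
    case True
    then show ?thesis
      using finite_index_if_cover_by_cosets[OF H] insert.prems by blast
  next
    case False
    then obtain g where g: "g \<in> carrier G" "\<And>t. t \<in> T \<Longrightarrow> g \<notin> H +> t" by blast
    define T' where "T' = T \<union> (\<lambda>(t,u). u \<ominus> g \<oplus> t) ` (T \<times> T)"
    have "\<exists>K\<in>HH. finite (a_rcosets K)"
    proof (rule insert.IH)
      show "\<forall>H\<in>HH. additive_subgroup H G" "finite T'" "T' \<subseteq> carrier G"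
        using insert.prems g by (auto simp: T'_def)
      show "carrier G \<subseteq> (\<Union>K\<in>HH. \<Union>t\<in>T'. K +> t)"
      proof
        fix x assume x: "x \<in> carrier G"
        then obtain K t where K: "K \<in> insert H HH" "t \<in> T" "x \<in> K +> t"
          using insert.prems(4) by blast
        show "x \<in> (\<Union>K\<in>HH. \<Union>t\<in>T'. K +> t)"
        proof (cases "K = H")
          case False
          with K show ?thesis by (auto simp: T'_def)
        next
          case True
          have t: "t \<in> carrier G" using K insert.prems by blast
          \<comment> \<open>\<open>z\<close> is \<open>x\<close> moved from the coset of \<open>t\<close> into the uncovered coset of \<open>g\<close>.\<close>
          define z where "z = x \<ominus> t \<oplus> g"
          have z: "z \<in> carrier G" using x t g by (simp add: z_def)
          have "z \<ominus> g = x \<ominus> t"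
            using x t g by (simp add: z_def minus_eq a_assoc r_neg)
          then have zg: "z \<ominus> g \<in> H"
            using K True mem_a_r_coset_iff[OF H x t] by simp
          obtain K' u where K': "K' \<in> insert H HH" "u \<in> T" "z \<in> K' +> u"
            using insert.prems(4) z by blast
          have u: "u \<in> carrier G" using K' insert.prems by blast
          have "K' \<noteq> H"
          proof
            assume "K' = H"
            then have "H +> g = H +> u"
              using K'(3) zg z u g a_r_coset_eq_iff[OF H] mem_a_r_coset_iff[OF H] by metis
            then show False
              using g K'(2) a_r_coset_eq_iff[OF H] mem_a_r_coset_iff[OF H] u by metis
          qed
          moreover have "z \<ominus> u = x \<ominus> (u \<ominus> g \<oplus> t)"
            using x t g u by (simp add: z_def minus_eq minus_add a_ac)
          ultimately have "x \<in> K' +> (u \<ominus> g \<oplus> t)" "K' \<in> HH"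
            using K' mem_a_r_coset_iff[of K'] insert.prems(1) z u x g t by auto
          moreover have "u \<ominus> g \<oplus> t \<in> T'"
            using K(2) K'(2) unfolding T'_def by (intro UnI2) force
          ultimately show ?thesis by blast
        qed
      qed
    qed
    then show ?thesis by blast
  qed
qed

text \<open>
  A coset of the intersection is the intersection of cosets, one of each subgroup, so there are only
  finitely many. Intersecting with the carrier makes the empty family harmless.
\<close>

lemma finite_index_Inter:
  assumes "finite HH" "\<And>H. H \<in> HH \<Longrightarrow> additive_subgroup H G"
    and fin: "\<And>H. H \<in> HH \<Longrightarrow> finite (a_rcosets H)"
  shows "additive_subgroup (carrier G \<inter> \<Inter>HH) G" "finite (a_rcosets (carrier G \<inter> \<Inter>HH))"
proof -
  let ?D = "carrier G \<inter> \<Inter>HH"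
  show D: "additive_subgroup ?D G"
  proof (intro additive_subgroup.intro add.subgroupI)
    have "\<zero> \<in> ?D" using assms(2) additive_subgroup.zero_closed by fastforce
    then show "?D \<noteq> {}" by blast
    show "\<ominus> a \<in> ?D" if "a \<in> ?D" for a
      using that assms(2) additive_subgroup.a_inv_closed
      by fastforce
    show "a \<oplus> b \<in> ?D" if "a \<in> ?D" "b \<in> ?D" for a b
      using that assms(2) additive_subgroup.a_closed by fastforce
  qed auto
  show "finite (a_rcosets ?D)"
  proof (rule finite_subset)
    show "a_rcosets ?D \<subseteq> (\<lambda>A. carrier G \<inter> \<Inter>A) ` Pow (\<Union>H\<in>HH. a_rcosets H)"
    proof
      fix X assume "X \<in> a_rcosets ?D"
      then obtain x where x: "x \<in> carrier G" "X = ?D +> x"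
        by (auto simp: A_RCOSETS_def')
      have "y \<in> X \<longleftrightarrow> y \<in> carrier G \<inter> \<Inter>((\<lambda>H. H +> x) ` HH)" for y
      proof (cases "y \<in> carrier G")
        case True
        then show ?thesis
          using x mem_a_r_coset_iff[OF D True x(1)] mem_a_r_coset_iff[OF assms(2) True x(1)]
          by auto
      next
        case False
        then show ?thesis
          using x a_r_coset_subset_G[of ?D x] by auto
      qed
      then have "X = carrier G \<inter> \<Inter>((\<lambda>H. H +> x) ` HH)" by blast
      moreover have "(\<lambda>H. H +> x) ` HH \<subseteq> (\<Union>H\<in>HH. a_rcosets H)"
        using x by (auto simp: A_RCOSETS_def')
      ultimately show "X \<in> (\<lambda>A. carrier G \<inter> \<Inter>A) ` Pow (\<Union>H\<in>HH. a_rcosets H)"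
        by blast
    qed
  qed (use assms(1) fin in auto)
qed

text \<open>
  B. H. Neumann's theorem for abelian groups. Let \<open>D\<close> be the intersection of the members of finite
  index. If these members missed a point \<open>x\<close>, they would miss the whole coset \<open>D + x\<close>, which would then
  be covered by members of infinite index. As \<open>D\<close> has finite index, finitely many translates of
  this covering would cover the group by cosets of subgroups of infinite index, which is impossible.
\<close>

lemma finite_index_if_irredundant_cover:
  assumes "finite HH" and sub: "\<And>H. H \<in> HH \<Longrightarrow> additive_subgroup H G"
    and cover: "\<Union>HH = carrier G" and irr: "\<And>KK. KK \<subset> HH \<Longrightarrow> \<Union>KK \<noteq> carrier G"
    and "H \<in> HH"
  shows "finite (a_rcosets H)"
proof (rule ccontr)
  assume inf: "infinite (a_rcosets H)"
  define FF where "FF = {K\<in>HH. finite (a_rcosets K)}"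
  let ?D = "carrier G \<inter> \<Inter>FF"
  have FF: "finite FF" "\<And>K. K \<in> FF \<Longrightarrow> additive_subgroup K G"
      "\<And>K. K \<in> FF \<Longrightarrow> finite (a_rcosets K)"
    using assms(1) sub by (auto simp: FF_def)
  note D = finite_index_Inter[OF FF]
  have "FF \<subset> HH" using inf \<open>H \<in> HH\<close> by (auto simp: FF_def)
  then have "\<Union>FF \<noteq> carrier G" by (rule irr)
  moreover have "\<Union>FF \<subseteq> carrier G" using cover by (auto simp: FF_def)
  ultimately obtain x where x: "x \<in> carrier G" "x \<notin> \<Union>FF" by blast
  have "\<forall>X\<in>a_rcosets ?D. \<exists>t\<in>carrier G. X = ?D +> t"
    by (auto simp: A_RCOSETS_def')
  then obtain rep where rep: "\<And>X. X \<in> a_rcosets ?D \<Longrightarrow> rep X \<in> carrier G \<and> X = ?D +> rep X"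
    by metis
  define T where "T = (\<lambda>X. rep X \<ominus> x) ` (a_rcosets ?D)"
  have "\<exists>K\<in>HH - FF. finite (a_rcosets K)"
  proof (rule exists_finite_index_in_coset_cover)
    show "finite (HH - FF)" "\<forall>K\<in>HH - FF. additive_subgroup K G" using assms by auto
    show "finite T" "T \<subseteq> carrier G" using D(2) rep x by (auto simp: T_def)
    show "carrier G \<subseteq> (\<Union>K\<in>HH - FF. \<Union>t\<in>T. K +> t)"
    proof
      fix y assume y: "y \<in> carrier G"
      define t where "t = rep (?D +> y)"
      have Y: "?D +> y \<in> a_rcosets ?D" using y by (auto simp: A_RCOSETS_def')
      then have t: "t \<in> carrier G" "?D +> y = ?D +> t" using rep[OF Y] by (auto simp: t_def)
      then have yt: "y \<ominus> t \<in> ?D" using a_r_coset_eq_iff[OF D(1) y] by blast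
      \<comment> \<open>\<open>z\<close> is \<open>y\<close> moved from its coset of the intersection into the missed coset of \<open>x\<close>.\<close>
      define z where "z = (y \<ominus> t) \<oplus> x"
      have "z \<in> carrier G" using y t x by (simp add: z_def)
      then obtain K where K: "K \<in> HH" "z \<in> K" using cover by blast
      have "K \<notin> FF"
      proof
        assume "K \<in> FF"
        then interpret additive_subgroup K G using K sub by blast
        have "y \<ominus> t \<in> K" using yt \<open>K \<in> FF\<close> by blast
        then have "\<ominus> (y \<ominus> t) \<oplus> z \<in> K" using K by blast
        moreover have "\<ominus> (y \<ominus> t) \<oplus> z = x"
          using y t x by (simp add: z_def r_neg1)
        ultimately show False using x \<open>K \<in> FF\<close> by auto
      qed
      moreover have "z = y \<ominus> (t \<ominus> x)"
        using y t x by (simp add: z_def minus_eq minus_add a_ac)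
      then have "y \<in> K +> (t \<ominus> x)"
        using K sub y t x mem_a_r_coset_iff[of K y "t \<ominus> x"] by simp
      moreover have "t \<ominus> x \<in> T" using Y by (auto simp: T_def t_def)
      ultimately show "y \<in> (\<Union>K\<in>HH - FF. \<Union>t\<in>T. K +> t)" using K by blast
    qed
  qed
  then show False by (auto simp: FF_def)
qed

end

section \<open>Submodules and their quotients\<close>

context module
begin

lemma submodule_additive_subgroup:
  assumes "submodule R N M"
  shows "additive_subgroup N M"
proof -
  interpret N: LinearCombinations.submodule R N M by (rule assms)
  have neg: "\<ominus>\<^bsub>M\<^esub> x \<in> N" if "x \<in> N" for x
  proof -
    have "x \<in> carrier M" using that N.subset by blast
    then have "\<ominus>\<^bsub>M\<^esub> x = (\<ominus> \<one>) \<odot>\<^bsub>M\<^esub> x" by (simp add: smult_l_minus)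
    with that show ?thesis using N.smult_closed[of "\<ominus> \<one>" x] by simp
  qed
  show ?thesis
    using N.subset N.zero_closed neg by (intro additive_subgroup.intro M.add.subgroupI) blast+
qed

lemma submodule_simps:
  assumes "submodule R N M"
  shows submodule_carrier: "x \<in> N \<Longrightarrow> x \<in> carrier M"
    and submodule_zero: "\<zero>\<^bsub>M\<^esub> \<in> N"
    and submodule_add: "x \<in> N \<Longrightarrow> y \<in> N \<Longrightarrow> x \<oplus>\<^bsub>M\<^esub> y \<in> N"
    and submodule_smult: "r \<in> carrier R \<Longrightarrow> x \<in> N \<Longrightarrow> r \<odot>\<^bsub>M\<^esub> x \<in> N"
    and submodule_neg: "x \<in> N \<Longrightarrow> \<ominus>\<^bsub>M\<^esub> x \<in> N"
    and submodule_diff: "x \<in> N \<Longrightarrow> y \<in> N \<Longrightarrow> x \<ominus>\<^bsub>M\<^esub> y \<in> N"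
    and submodule_add_iff: "y \<in> N \<Longrightarrow> x \<in> carrier M \<Longrightarrow> x \<oplus>\<^bsub>M\<^esub> y \<in> N \<longleftrightarrow> x \<in> N"
    and submodule_add_iff': "y \<in> N \<Longrightarrow> x \<in> carrier M \<Longrightarrow> y \<oplus>\<^bsub>M\<^esub> x \<in> N \<longleftrightarrow> x \<in> N"
    and submodule_diff_iff: "y \<in> N \<Longrightarrow> x \<in> carrier M \<Longrightarrow> x \<ominus>\<^bsub>M\<^esub> y \<in> N \<longleftrightarrow> x \<in> N"
proof -
  interpret N: LinearCombinations.submodule R N M by (rule assms)
  interpret A: additive_subgroup N M by (rule submodule_additive_subgroup[OF assms])
  show carr: "x \<in> carrier M" if "x \<in> N" for x using that N.subset by blast
  show "\<zero>\<^bsub>M\<^esub> \<in> N" by simp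
  show add: "x \<oplus>\<^bsub>M\<^esub> y \<in> N" if "x \<in> N" "y \<in> N" for x y using that by simp
  show "r \<odot>\<^bsub>M\<^esub> x \<in> N" if "r \<in> carrier R" "x \<in> N" for r x using that by simp
  show neg: "\<ominus>\<^bsub>M\<^esub> x \<in> N" if "x \<in> N" for x using that by simp
  show diff: "x \<ominus>\<^bsub>M\<^esub> y \<in> N" if "x \<in> N" "y \<in> N" for x y
    using that by (simp add: M.minus_eq)
  show iff: "x \<oplus>\<^bsub>M\<^esub> y \<in> N \<longleftrightarrow> x \<in> N" if "y \<in> N" "x \<in> carrier M" for x y
  proof
    assume "x \<oplus>\<^bsub>M\<^esub> y \<in> N"
    then have "(x \<oplus>\<^bsub>M\<^esub> y) \<oplus>\<^bsub>M\<^esub> \<ominus>\<^bsub>M\<^esub> y \<in> N" using that by simp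
    then show "x \<in> N" using that carr by (simp add: M.a_assoc M.r_neg)
  qed (use that in simp)
  show "y \<oplus>\<^bsub>M\<^esub> x \<in> N \<longleftrightarrow> x \<in> N" if "y \<in> N" "x \<in> carrier M" for x y
    using iff[OF that] that carr by (simp add: M.a_comm)
  show "x \<ominus>\<^bsub>M\<^esub> y \<in> N \<longleftrightarrow> x \<in> N" if "y \<in> N" "x \<in> carrier M" for x y
    using iff[OF neg[OF that(1)] that(2)] by (simp add: M.minus_eq)
qed

lemma submoduleI':
  assumes "N \<subseteq> carrier M" "\<zero>\<^bsub>M\<^esub> \<in> N"
    "\<And>x y. x \<in> N \<Longrightarrow> y \<in> N \<Longrightarrow> x \<oplus>\<^bsub>M\<^esub> y \<in> N"
    "\<And>r x. r \<in> carrier R \<Longrightarrow> x \<in> N \<Longrightarrow> r \<odot>\<^bsub>M\<^esub> x \<in> N"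
  shows "submodule R N M"
  using assms module_axioms by unfold_locales auto

lemma submodule_carrier_self: "submodule R (carrier M) M"
  by (rule submoduleI') auto

text \<open>
  The submodule \<open>N + R x\<close>. All generation statements below (cyclic quotients, fibres spanned by one
  vector, hyperplanes) are expressed through it.
\<close>

definition adjoin :: "'c set \<Rightarrow> 'c \<Rightarrow> 'c set"
  where "adjoin N x = {n \<oplus>\<^bsub>M\<^esub> r \<odot>\<^bsub>M\<^esub> x | n r. n \<in> N \<and> r \<in> carrier R}"

lemma adjoin:
  assumes N: "submodule R N M" and x: "x \<in> carrier M"
  shows adjoin_submodule: "submodule R (adjoin N x) M"
    and subset_adjoin: "N \<subseteq> adjoin N x"
    and mem_adjoin: "x \<in> adjoin N x"
proof -
  note [simp] = submodule_simps[OF N]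
  show "submodule R (adjoin N x) M"
  proof (rule submoduleI')
    show "adjoin N x \<subseteq> carrier M" using x by (auto simp: adjoin_def)
    have "\<zero>\<^bsub>M\<^esub> = \<zero>\<^bsub>M\<^esub> \<oplus>\<^bsub>M\<^esub> \<zero> \<odot>\<^bsub>M\<^esub> x" using x by simp
    then show "\<zero>\<^bsub>M\<^esub> \<in> adjoin N x" unfolding adjoin_def by force
  next
    fix y z assume "y \<in> adjoin N x" "z \<in> adjoin N x"
    then obtain n r m s where yz: "y = n \<oplus>\<^bsub>M\<^esub> r \<odot>\<^bsub>M\<^esub> x" "z = m \<oplus>\<^bsub>M\<^esub> s \<odot>\<^bsub>M\<^esub> x"
        "n \<in> N" "m \<in> N" "r \<in> carrier R" "s \<in> carrier R"
      by (auto simp: adjoin_def)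
    then have "y \<oplus>\<^bsub>M\<^esub> z = (n \<oplus>\<^bsub>M\<^esub> m) \<oplus>\<^bsub>M\<^esub> (r \<oplus> s) \<odot>\<^bsub>M\<^esub> x"
      using x by (simp add: smult_l_distr M.a_ac)
    moreover have "n \<oplus>\<^bsub>M\<^esub> m \<in> N" "r \<oplus> s \<in> carrier R" using yz by auto
    ultimately show "y \<oplus>\<^bsub>M\<^esub> z \<in> adjoin N x" unfolding adjoin_def by blast
  next
    fix a y assume a: "a \<in> carrier R" and "y \<in> adjoin N x"
    then obtain n r where y: "y = n \<oplus>\<^bsub>M\<^esub> r \<odot>\<^bsub>M\<^esub> x" "n \<in> N" "r \<in> carrier R"
      by (auto simp: adjoin_def)
    then have "a \<odot>\<^bsub>M\<^esub> y = a \<odot>\<^bsub>M\<^esub> n \<oplus>\<^bsub>M\<^esub> (a \<otimes> r) \<odot>\<^bsub>M\<^esub> x"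
      using x a by (simp add: smult_r_distr smult_assoc1)
    moreover have "a \<odot>\<^bsub>M\<^esub> n \<in> N" "a \<otimes> r \<in> carrier R" using y a by auto
    ultimately show "a \<odot>\<^bsub>M\<^esub> y \<in> adjoin N x" unfolding adjoin_def by blast
  qed
  show "N \<subseteq> adjoin N x"
  proof
    fix n assume "n \<in> N"
    then have "n = n \<oplus>\<^bsub>M\<^esub> \<zero> \<odot>\<^bsub>M\<^esub> x" using x by simp
    with \<open>n \<in> N\<close> show "n \<in> adjoin N x" unfolding adjoin_def by blast
  qed
  have "x = \<zero>\<^bsub>M\<^esub> \<oplus>\<^bsub>M\<^esub> \<one> \<odot>\<^bsub>M\<^esub> x" using x by simp
  then show "x \<in> adjoin N x" unfolding adjoin_def by force
qed

lemma adjoin_subset: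
  assumes "submodule R K M" "N \<subseteq> K" "x \<in> K"
  shows "adjoin N x \<subseteq> K"
  using assms submodule_simps[OF assms(1)] by (auto simp: adjoin_def)

lemma mem_adjoin_iff:
  assumes N: "submodule R N M" and x: "x \<in> carrier M" and z: "z \<in> carrier M"
  shows "z \<in> adjoin N x \<longleftrightarrow> (\<exists>r\<in>carrier R. N +>\<^bsub>M\<^esub> z = N +>\<^bsub>M\<^esub> (r \<odot>\<^bsub>M\<^esub> x))"
proof -
  note [simp] = submodule_simps[OF N]
  have "z \<in> adjoin N x \<longleftrightarrow> (\<exists>r\<in>carrier R. z \<ominus>\<^bsub>M\<^esub> r \<odot>\<^bsub>M\<^esub> x \<in> N)"
  proof
    assume "z \<in> adjoin N x"
    then obtain n r where nr: "n \<in> N" "r \<in> carrier R" "z = n \<oplus>\<^bsub>M\<^esub> r \<odot>\<^bsub>M\<^esub> x"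
      by (auto simp: adjoin_def)
    then have "z \<ominus>\<^bsub>M\<^esub> r \<odot>\<^bsub>M\<^esub> x = n"
      using x by (simp add: M.minus_eq M.a_assoc M.r_neg)
    then show "\<exists>r\<in>carrier R. z \<ominus>\<^bsub>M\<^esub> r \<odot>\<^bsub>M\<^esub> x \<in> N"
      using nr(1,2) by force
  next
    assume "\<exists>r\<in>carrier R. z \<ominus>\<^bsub>M\<^esub> r \<odot>\<^bsub>M\<^esub> x \<in> N"
    then obtain r where r: "r \<in> carrier R" "z \<ominus>\<^bsub>M\<^esub> r \<odot>\<^bsub>M\<^esub> x \<in> N" by blast
    have "z = (z \<ominus>\<^bsub>M\<^esub> r \<odot>\<^bsub>M\<^esub> x) \<oplus>\<^bsub>M\<^esub> r \<odot>\<^bsub>M\<^esub> x"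
      using r x z by (simp add: M.minus_eq M.a_assoc M.l_neg)
    with r show "z \<in> adjoin N x" unfolding adjoin_def by blast
  qed
  then show ?thesis
    using M.a_r_coset_eq_iff[OF submodule_additive_subgroup[OF N]] x z by auto
qed

lemma adjoin_eq_carrier_iff:
  assumes N: "submodule R N M" and x: "x \<in> carrier M"
  shows "adjoin N x = carrier M \<longleftrightarrow>
    (\<lambda>r. N +>\<^bsub>M\<^esub> (r \<odot>\<^bsub>M\<^esub> x)) ` carrier R = (\<lambda>z. N +>\<^bsub>M\<^esub> z) ` carrier M"
    (is "_ \<longleftrightarrow> ?f ` carrier R = ?g ` carrier M")
proof -
  have "adjoin N x = carrier M \<longleftrightarrow> carrier M \<subseteq> adjoin N x"
    using submodule_carrier[OF adjoin_submodule[OF N x]] by blast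
  also have "\<dots> \<longleftrightarrow> (\<forall>z\<in>carrier M. \<exists>r\<in>carrier R. ?g z = ?f r)"
    using mem_adjoin_iff[OF N x] by blast
  also have "\<dots> \<longleftrightarrow> ?g ` carrier M \<subseteq> ?f ` carrier R"
    by (simp add: image_subset_iff image_iff)
  also have "\<dots> \<longleftrightarrow> ?f ` carrier R = ?g ` carrier M"
  proof -
    have "?f ` carrier R \<subseteq> ?g ` carrier M" using x by auto
    then show ?thesis by (simp only: set_eq_subset simp_thms)
  qed
  finally show ?thesis .
qed

text \<open>
  The union that defines scalar multiplication on the quotient has all its terms equal.
\<close>

lemma coset_smult:
  assumes N: "submodule R N M" and r: "r \<in> carrier R" and x: "x \<in> carrier M"
  shows "(\<Union>y\<in>N +>\<^bsub>M\<^esub> x. N +>\<^bsub>M\<^esub> (r \<odot>\<^bsub>M\<^esub> y)) = N +>\<^bsub>M\<^esub> (r \<odot>\<^bsub>M\<^esub> x)"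
proof -
  note A = submodule_additive_subgroup[OF N]
  note [simp] = submodule_simps[OF N]
  have "N +>\<^bsub>M\<^esub> (r \<odot>\<^bsub>M\<^esub> y) = N +>\<^bsub>M\<^esub> (r \<odot>\<^bsub>M\<^esub> x)" if y: "y \<in> N +>\<^bsub>M\<^esub> x" for y
  proof -
    have yM: "y \<in> carrier M"
      using y x M.a_r_coset_subset_G[of N x] submodule_carrier[OF N] by blast
    have "y \<ominus>\<^bsub>M\<^esub> x \<in> N" using y yM x M.mem_a_r_coset_iff[OF A] by blast
    then have "r \<odot>\<^bsub>M\<^esub> (y \<ominus>\<^bsub>M\<^esub> x) \<in> N" using r by simp
    moreover have "r \<odot>\<^bsub>M\<^esub> (y \<ominus>\<^bsub>M\<^esub> x) = r \<odot>\<^bsub>M\<^esub> y \<ominus>\<^bsub>M\<^esub> r \<odot>\<^bsub>M\<^esub> x"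
      using r x yM by (simp add: M.minus_eq smult_r_distr smult_r_minus)
    ultimately show ?thesis
      using M.a_r_coset_eq_iff[OF A] r x yM by simp
  qed
  moreover have "x \<in> N +>\<^bsub>M\<^esub> x"
    using M.mem_a_r_coset_iff[OF A x x] x by (simp add: M.minus_eq M.r_neg)
  ultimately show ?thesis by blast
qed

lemma quot_module_simps:
  assumes N: "submodule R N M"
  shows quot_carrier: "carrier (quot_module M N) = (\<lambda>x. N +>\<^bsub>M\<^esub> x) ` carrier M"
    and quot_zero: "\<zero>\<^bsub>quot_module M N\<^esub> = N +>\<^bsub>M\<^esub> \<zero>\<^bsub>M\<^esub>"
    and quot_add: "x \<in> carrier M \<Longrightarrow> y \<in> carrier M \<Longrightarrow>
      (N +>\<^bsub>M\<^esub> x) \<oplus>\<^bsub>quot_module M N\<^esub> (N +>\<^bsub>M\<^esub> y) = N +>\<^bsub>M\<^esub> (x \<oplus>\<^bsub>M\<^esub> y)"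
    and quot_smult: "r \<in> carrier R \<Longrightarrow> x \<in> carrier M \<Longrightarrow>
      r \<odot>\<^bsub>quot_module M N\<^esub> (N +>\<^bsub>M\<^esub> x) = N +>\<^bsub>M\<^esub> (r \<odot>\<^bsub>M\<^esub> x)"
proof -
  interpret A: abelian_subgroup N M
    by (rule abelian_subgroupI3[OF submodule_additive_subgroup[OF N] M.abelian_group_axioms])
  show "carrier (quot_module M N) = (\<lambda>x. N +>\<^bsub>M\<^esub> x) ` carrier M"
    by (auto simp: quot_module_def A_RCOSETS_def')
  show "\<zero>\<^bsub>quot_module M N\<^esub> = N +>\<^bsub>M\<^esub> \<zero>\<^bsub>M\<^esub>"
    using A.a_subset by (simp add: quot_module_def)
  show "(N +>\<^bsub>M\<^esub> x) \<oplus>\<^bsub>quot_module M N\<^esub> (N +>\<^bsub>M\<^esub> y) = N +>\<^bsub>M\<^esub> (x \<oplus>\<^bsub>M\<^esub> y)"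
    if "x \<in> carrier M" "y \<in> carrier M"
    using A.a_rcos_sum[OF that] by (simp add: quot_module_def)
  show "r \<odot>\<^bsub>quot_module M N\<^esub> (N +>\<^bsub>M\<^esub> x) = N +>\<^bsub>M\<^esub> (r \<odot>\<^bsub>M\<^esub> x)"
    if "r \<in> carrier R" "x \<in> carrier M"
    using coset_smult[OF N that] by (simp add: quot_module_def)
qed

lemma quot_module_module:
  assumes N: "submodule R N M"
  shows "module R (quot_module M N)"
proof (rule moduleI)
  note S = quot_module_simps[OF N]
  show "cring R" by (rule R.is_cring)
  show "abelian_group (quot_module M N)"
  proof (rule abelian_groupI)
    fix X assume "X \<in> carrier (quot_module M N)"
    then obtain x where x: "x \<in> carrier M" "X = N +>\<^bsub>M\<^esub> x" by (auto simp: S)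
    then have "(N +>\<^bsub>M\<^esub> (\<ominus>\<^bsub>M\<^esub> x)) \<oplus>\<^bsub>quot_module M N\<^esub> X = \<zero>\<^bsub>quot_module M N\<^esub>"
      by (simp add: S M.l_neg)
    then show "\<exists>Y\<in>carrier (quot_module M N). Y \<oplus>\<^bsub>quot_module M N\<^esub> X = \<zero>\<^bsub>quot_module M N\<^esub>"
      using x by (auto simp: S)
  qed (auto simp: S M.a_ac)
qed (auto simp: quot_module_simps[OF N] smult_l_distr smult_r_distr smult_assoc1)

lemma span_singleton:
  assumes "x \<in> carrier M"
  shows "span {x} = (\<lambda>r. r \<odot>\<^bsub>M\<^esub> x) ` carrier R"
proof -
  have "span {x} = {lincomb a {x} | a. a \<in> {x} \<rightarrow> carrier R}"
    using assms by (intro finite_span) auto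
  also have "\<dots> = {a x \<odot>\<^bsub>M\<^esub> x | a. a \<in> {x} \<rightarrow> carrier R}"
    using assms unfolding lincomb_def by (intro Collect_cong ex_cong1) auto
  also have "\<dots> = (\<lambda>r. r \<odot>\<^bsub>M\<^esub> x) ` carrier R"
    by (auto intro: exI[of _ "\<lambda>_. r" for r])
  finally show ?thesis .
qed

lemma cyclic_quot_module_iff:
  assumes N: "submodule R N M"
  shows "cyclic_module R (quot_module M N) \<longleftrightarrow> (\<exists>x\<in>carrier M. adjoin N x = carrier M)"
proof -
  note S = quot_module_simps[OF N]
  interpret Q: module R "quot_module M N" by (rule quot_module_module[OF N])
  have "module.span R (quot_module M N) {N +>\<^bsub>M\<^esub> x} = carrier (quot_module M N)
      \<longleftrightarrow> adjoin N x = carrier M" if x: "x \<in> carrier M" for x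
  proof -
    let ?f = "\<lambda>r. N +>\<^bsub>M\<^esub> (r \<odot>\<^bsub>M\<^esub> x)"
    have "Q.span {N +>\<^bsub>M\<^esub> x} = ?f ` carrier R"
      using Q.span_singleton[of "N +>\<^bsub>M\<^esub> x"] x S(1) S(4)[OF _ x] by simp
    then show ?thesis by (simp add: S(1) adjoin_eq_carrier_iff[OF N x])
  qed
  then show ?thesis
    unfolding cyclic_module_def using S(1) by auto
qed

end

section \<open>The fibre at a maximal ideal\<close>

text \<open>
  A generating set with at most one element may be taken to be a singleton, as the empty set
  generates no more than \<open>{0}\<close> does. This describes large dimension, the infinite case included,
  without bases.
\<close>

lemma (in vectorspace) dim_ge_two_iff:
  "\<not> fin_dim \<or> dim \<ge> 2 \<longleftrightarrow> (\<forall>x\<in>carrier V. span {x} \<noteq> carrier V)"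
proof
  assume large: "\<not> fin_dim \<or> dim \<ge> 2"
  show "\<forall>x\<in>carrier V. span {x} \<noteq> carrier V"
  proof (intro ballI notI)
    fix x assume x: "x \<in> carrier V" "span {x} = carrier V"
    then have "\<exists>A. finite A \<and> card A = 1 \<and> A \<subseteq> carrier V \<and> gen_set A"
      by (intro exI[of _ "{x}"]) simp
    then have "dim \<le> 1" unfolding dim_def by (rule Least_le)
    moreover have "fin_dim"
      unfolding fin_dim_def using x by (intro exI[of _ "{x}"]) simp
    ultimately show False using large by simp
  qed
next
  assume none: "\<forall>x\<in>carrier V. span {x} \<noteq> carrier V"
  show "\<not> fin_dim \<or> dim \<ge> 2"
  proof (rule ccontr)
    assume small: "\<not> (\<not> fin_dim \<or> dim \<ge> 2)"
    then have "\<exists>n A. finite A \<and> card A = n \<and> A \<subseteq> carrier V \<and> gen_set A"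
      by (auto simp: fin_dim_def)
    then have "\<exists>A. finite A \<and> card A = dim \<and> A \<subseteq> carrier V \<and> gen_set A"
      unfolding dim_def by (rule LeastI_ex)
    then obtain A where A: "finite A" "card A = dim" "A \<subseteq> carrier V" "gen_set A" by blast
    moreover have "card A = 0 \<or> card A = 1" using small A by linarith
    moreover have zeroV: "\<zero>\<^bsub>V\<^esub> \<in> carrier V" by simp
    ultimately obtain x where x: "x \<in> carrier V" "A \<subseteq> {x}"
      by (auto simp: card_1_singleton_iff intro: that[of "\<zero>\<^bsub>V\<^esub>"])
    then have "span {x} = carrier V"
      using span_is_monotone[OF x(2)] span_is_subset2[of "{x}"] A(4) by auto
    then show False using none x by blast
  qed
qed

context module
begin

lemma ideal_smult_props:
  assumes I: "ideal I R"
  shows ideal_smult_submodule: "submodule R (ideal_smult R M I) M"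
    and smult_mem_ideal_smult: "a \<in> I \<Longrightarrow> x \<in> carrier M \<Longrightarrow> a \<odot>\<^bsub>M\<^esub> x \<in> ideal_smult R M I"
proof -
  have sub: "{a \<odot>\<^bsub>M\<^esub> x | a x. a \<in> I \<and> x \<in> carrier M} \<subseteq> carrier M"
    using ideal.Icarr[OF I] by auto
  show "submodule R (ideal_smult R M I) M"
    unfolding ideal_smult_def by (rule span_is_submodule[OF sub])
  show "a \<odot>\<^bsub>M\<^esub> x \<in> ideal_smult R M I" if "a \<in> I" "x \<in> carrier M"
    using in_own_span[OF sub] that unfolding ideal_smult_def by blast
qed

lemma ideal_smult_subset:
  assumes "submodule R L M" "\<And>a x. a \<in> I \<Longrightarrow> x \<in> carrier M \<Longrightarrow> a \<odot>\<^bsub>M\<^esub> x \<in> L"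
  shows "ideal_smult R M I \<subseteq> L"
  unfolding ideal_smult_def using assms by (intro span_is_subset) auto

text \<open>
  Another representative of the coset \<open>I + a\<close> changes \<open>a x\<close> by an element of \<open>I M\<close>.
\<close>

lemma reduction_simps:
  assumes I: "ideal I R"
  defines "N \<equiv> ideal_smult R M I"
  shows reduction_carrier: "carrier (reduction R M I) = (\<lambda>x. N +>\<^bsub>M\<^esub> x) ` carrier M"
    and reduction_zero: "\<zero>\<^bsub>reduction R M I\<^esub> = N +>\<^bsub>M\<^esub> \<zero>\<^bsub>M\<^esub>"
    and reduction_add: "x \<in> carrier M \<Longrightarrow> y \<in> carrier M \<Longrightarrow>
      (N +>\<^bsub>M\<^esub> x) \<oplus>\<^bsub>reduction R M I\<^esub> (N +>\<^bsub>M\<^esub> y) = N +>\<^bsub>M\<^esub> (x \<oplus>\<^bsub>M\<^esub> y)"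
    and reduction_smult: "a \<in> carrier R \<Longrightarrow> x \<in> carrier M \<Longrightarrow>
      (I +> a) \<odot>\<^bsub>reduction R M I\<^esub> (N +>\<^bsub>M\<^esub> x) = N +>\<^bsub>M\<^esub> (a \<odot>\<^bsub>M\<^esub> x)"
proof -
  note N = ideal_smult_submodule[OF I, folded N_def]
  have eq: "carrier (reduction R M I) = carrier (quot_module M N)"
    "\<zero>\<^bsub>reduction R M I\<^esub> = \<zero>\<^bsub>quot_module M N\<^esub>"
    "add (reduction R M I) = add (quot_module M N)"
    by (simp_all add: reduction_def quot_module_def N_def Let_def)
  show "carrier (reduction R M I) = (\<lambda>x. N +>\<^bsub>M\<^esub> x) ` carrier M"
    "\<zero>\<^bsub>reduction R M I\<^esub> = N +>\<^bsub>M\<^esub> \<zero>\<^bsub>M\<^esub>"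
    "x \<in> carrier M \<Longrightarrow> y \<in> carrier M \<Longrightarrow>
      (N +>\<^bsub>M\<^esub> x) \<oplus>\<^bsub>reduction R M I\<^esub> (N +>\<^bsub>M\<^esub> y) = N +>\<^bsub>M\<^esub> (x \<oplus>\<^bsub>M\<^esub> y)"
    by (simp_all add: eq quot_module_simps[OF N])
  show "(I +> a) \<odot>\<^bsub>reduction R M I\<^esub> (N +>\<^bsub>M\<^esub> x) = N +>\<^bsub>M\<^esub> (a \<odot>\<^bsub>M\<^esub> x)"
    if a: "a \<in> carrier R" and x: "x \<in> carrier M"
  proof -
    have A: "additive_subgroup I R" by (rule ideal.axioms(1)[OF I])
    have "(\<Union>y\<in>N +>\<^bsub>M\<^esub> x. N +>\<^bsub>M\<^esub> (b \<odot>\<^bsub>M\<^esub> y)) = N +>\<^bsub>M\<^esub> (a \<odot>\<^bsub>M\<^esub> x)" if b: "b \<in> I +> a" for b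
    proof -
      have bR: "b \<in> carrier R"
        using b a R.a_r_coset_subset_G[of I a] ideal.Icarr[OF I] by blast
      then have "b \<ominus> a \<in> I" using b a R.mem_a_r_coset_iff[OF A] by blast
      then have "(b \<ominus> a) \<odot>\<^bsub>M\<^esub> x \<in> N"
        using smult_mem_ideal_smult[OF I _ x] by (simp add: N_def)
      moreover have "(b \<ominus> a) \<odot>\<^bsub>M\<^esub> x = b \<odot>\<^bsub>M\<^esub> x \<ominus>\<^bsub>M\<^esub> a \<odot>\<^bsub>M\<^esub> x"
        using a bR x by (simp add: R.minus_eq M.minus_eq smult_l_distr smult_l_minus)
      ultimately have "N +>\<^bsub>M\<^esub> (b \<odot>\<^bsub>M\<^esub> x) = N +>\<^bsub>M\<^esub> (a \<odot>\<^bsub>M\<^esub> x)"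
        using M.a_r_coset_eq_iff[OF submodule_additive_subgroup[OF N]] a bR x by simp
      then show ?thesis using coset_smult[OF N bR x] by simp
    qed
    moreover have "a \<in> I +> a"
      using R.mem_a_r_coset_iff[OF A a a] a additive_subgroup.zero_closed[OF A]
      by (simp add: R.minus_eq R.r_neg)
    ultimately show ?thesis
      by (auto simp add: reduction_def N_def Let_def)
  qed
qed

lemma carrier_factor_ring: "carrier (R Quot I) = (\<lambda>a. I +> a) ` carrier R"
  by (auto simp: FactRing_def A_RCOSETS_def')

lemma factor_ring_simps:
  assumes I: "ideal I R"
  shows "\<one>\<^bsub>R Quot I\<^esub> = I +> \<one>"
    and "a \<in> carrier R \<Longrightarrow> b \<in> carrier R \<Longrightarrow> (I +> a) \<oplus>\<^bsub>R Quot I\<^esub> (I +> b) = I +> (a \<oplus> b)"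
    and "a \<in> carrier R \<Longrightarrow> b \<in> carrier R \<Longrightarrow> (I +> a) \<otimes>\<^bsub>R Quot I\<^esub> (I +> b) = I +> (a \<otimes> b)"
proof -
  interpret I: ideal I R by (rule I)
  show "\<one>\<^bsub>R Quot I\<^esub> = I +> \<one>" by (simp add: FactRing_def)
  show "(I +> a) \<oplus>\<^bsub>R Quot I\<^esub> (I +> b) = I +> (a \<oplus> b)"
    "(I +> a) \<otimes>\<^bsub>R Quot I\<^esub> (I +> b) = I +> (a \<otimes> b)" if "a \<in> carrier R" "b \<in> carrier R"
    using that by (simp_all add: FactRing_def I.a_rcos_sum I.rcoset_mult_add)
qed

lemma reduction_module:
  assumes I: "ideal I R"
  shows "module (R Quot I) (reduction R M I)"
proof (rule moduleI)
  let ?N = "ideal_smult R M I" and ?Q = "reduction R M I"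
  note S = reduction_simps[OF I]
  show "cring (R Quot I)" by (rule ideal.quotient_is_cring[OF I R.is_cring])
  show "abelian_group ?Q"
  proof (rule abelian_groupI)
    fix X assume "X \<in> carrier ?Q"
    then obtain x where x: "x \<in> carrier M" "X = ?N +>\<^bsub>M\<^esub> x" by (auto simp: S)
    then have "(?N +>\<^bsub>M\<^esub> (\<ominus>\<^bsub>M\<^esub> x)) \<oplus>\<^bsub>?Q\<^esub> X = \<zero>\<^bsub>?Q\<^esub>"
      by (simp add: S M.l_neg)
    then show "\<exists>Y\<in>carrier ?Q. Y \<oplus>\<^bsub>?Q\<^esub> X = \<zero>\<^bsub>?Q\<^esub>"
      using x by (auto simp: S)
  qed (auto simp: S M.a_ac)
next
  note S = reduction_simps[OF I] and F = factor_ring_simps[OF I] carrier_factor_ring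
  fix X assume "X \<in> carrier (reduction R M I)"
  then obtain x where x: "x \<in> carrier M" "X = ideal_smult R M I +>\<^bsub>M\<^esub> x"
    by (auto simp: S(1))
  show "\<one>\<^bsub>R Quot I\<^esub> \<odot>\<^bsub>reduction R M I\<^esub> X = X"
    using x by (simp add: S F)
  fix A assume "A \<in> carrier (R Quot I)"
  then obtain a where a: "a \<in> carrier R" "A = I +> a"
    by (auto simp: carrier_factor_ring)
  show "A \<odot>\<^bsub>reduction R M I\<^esub> X \<in> carrier (reduction R M I)"
    using a x by (simp add: S)
  {
    fix Y assume "Y \<in> carrier (reduction R M I)"
    then obtain y where "y \<in> carrier M" "Y = ideal_smult R M I +>\<^bsub>M\<^esub> y"
      by (auto simp: S(1))
    then show "A \<odot>\<^bsub>reduction R M I\<^esub> (X \<oplus>\<^bsub>reduction R M I\<^esub> Y) =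
        A \<odot>\<^bsub>reduction R M I\<^esub> X \<oplus>\<^bsub>reduction R M I\<^esub> A \<odot>\<^bsub>reduction R M I\<^esub> Y"
      using a x by (simp add: S smult_r_distr)
  }
  fix B assume "B \<in> carrier (R Quot I)"
  then obtain b where b: "b \<in> carrier R" "B = I +> b"
    by (auto simp: carrier_factor_ring)
  show "(A \<oplus>\<^bsub>R Quot I\<^esub> B) \<odot>\<^bsub>reduction R M I\<^esub> X =
      A \<odot>\<^bsub>reduction R M I\<^esub> X \<oplus>\<^bsub>reduction R M I\<^esub> B \<odot>\<^bsub>reduction R M I\<^esub> X"
    using a b x by (simp add: S F smult_l_distr)
  show "(A \<otimes>\<^bsub>R Quot I\<^esub> B) \<odot>\<^bsub>reduction R M I\<^esub> X =
      A \<odot>\<^bsub>reduction R M I\<^esub> (B \<odot>\<^bsub>reduction R M I\<^esub> X)"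
    using a b x by (simp add: S F smult_assoc1)
qed

text \<open>
  All later use of \<open>large_fibres\<close> goes through this form, which refers to \<open>M\<close> and the submodule \<open>I M\<close>
  alone, so that no computation takes place in the quotient space.
\<close>

lemma large_fibres_iff:
  "I \<in> large_fibres R M \<longleftrightarrow>
    maximalideal I R \<and> (\<forall>x\<in>carrier M. adjoin (ideal_smult R M I) x \<noteq> carrier M)"
proof (cases "maximalideal I R")
  case True
  then interpret I: maximalideal I R .
  have I: "ideal I R" by (rule I.ideal_axioms)
  let ?N = "ideal_smult R M I"
  note S = reduction_simps[OF I] and N = ideal_smult_submodule[OF I]
  interpret Q: vectorspace "R Quot I" "reduction R M I"
    by (intro vectorspace.intro reduction_module I I.quotient_is_field R.is_cring)
  have "Q.span {?N +>\<^bsub>M\<^esub> x} = carrier (reduction R M I) \<longleftrightarrow> adjoin ?N x = carrier M"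
    if x: "x \<in> carrier M" for x
  proof -
    let ?f = "\<lambda>r. ?N +>\<^bsub>M\<^esub> (r \<odot>\<^bsub>M\<^esub> x)"
    have "Q.span {?N +>\<^bsub>M\<^esub> x} = ?f ` carrier R"
      using Q.span_singleton[of "?N +>\<^bsub>M\<^esub> x"] x S(1) S(4)[OF _ x]
      by (simp add: carrier_factor_ring image_image)
    then show ?thesis by (simp add: S(1) adjoin_eq_carrier_iff[OF N x])
  qed
  then show ?thesis
    using True Q.dim_ge_two_iff unfolding large_fibres_def S(1) by auto
qed (simp add: large_fibres_def)

end

section \<open>Covering a large fibre by lines\<close>

lemma (in cring) maximalideal_unit_mod:
  assumes "maximalideal I R" "r \<in> carrier R" "r \<notin> I"
  shows "\<exists>s\<in>carrier R. \<one> \<ominus> s \<otimes> r \<in> I"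
proof -
  interpret I: maximalideal I R by fact
  let ?J = "set_add R I (PIdl r)"
  have J: "ideal ?J R" by (intro add_ideals I.ideal_axioms cgenideal_ideal assms)
  have "i \<in> ?J" if "i \<in> I" for i
  proof -
    have "\<zero> \<in> PIdl r" using assms(2) unfolding cgenideal_def by (auto intro!: exI[of _ \<zero>])
    moreover have "i = i \<oplus> \<zero>" using that I.Icarr by simp
    ultimately show ?thesis using that unfolding set_add_def' by blast
  qed
  moreover have "r \<in> ?J"
  proof -
    have "r = \<zero> \<oplus> r" "\<zero> \<in> I" using assms(2) by simp_all
    then show ?thesis using cgenideal_self[OF assms(2)] unfolding set_add_def' by blast
  qed
  ultimately have "?J = carrier R"
    using I.I_maximal[OF J] assms(3) ideal.Icarr[OF J] by blast
  then obtain i s where i_s: "i \<in> I" "s \<in> carrier R" "\<one> = i \<oplus> s \<otimes> r"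
    using one_closed unfolding set_add_def' cgenideal_def by blast
  then have "\<one> \<ominus> s \<otimes> r = i"
    using assms(2) I.Icarr by (simp add: minus_eq a_assoc r_neg)
  with i_s show ?thesis by blast
qed

context module
begin

lemma smult_split:
  assumes "r \<in> carrier R" "x \<in> carrier M"
  shows "(\<one> \<ominus> r) \<odot>\<^bsub>M\<^esub> x \<oplus>\<^bsub>M\<^esub> r \<odot>\<^bsub>M\<^esub> x = x"
proof -
  have "(\<one> \<ominus> r) \<oplus> r = \<one>" using assms by (simp add: R.minus_eq R.a_assoc R.l_neg)
  then show ?thesis using assms smult_l_distr[of "\<one> \<ominus> r" r x] by simp
qed

text \<open>
  If \<open>I x\<close> lies in \<open>K\<close>, then the class of \<open>x\<close> in \<open>M/K\<close> is a vector over the field \<open>R/I\<close>, and a scalar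
  outside \<open>I\<close> can be cancelled. With \<open>t s = 1\<close> modulo \<open>I\<close>, this reads \<open>x = (1 - t s) x + t (s x)\<close>.
\<close>

lemma mem_if_unit_smult_mem:
  assumes I: "maximalideal I R" and K: "submodule R K M" and x: "x \<in> carrier M"
    and Ix: "\<And>r. r \<in> I \<Longrightarrow> r \<odot>\<^bsub>M\<^esub> x \<in> K"
    and s: "s \<in> carrier R" "s \<notin> I" "s \<odot>\<^bsub>M\<^esub> x \<in> K"
  shows "x \<in> K"
proof -
  obtain t where t: "t \<in> carrier R" "\<one> \<ominus> t \<otimes> s \<in> I"
    using R.maximalideal_unit_mod[OF I s(1,2)] by blast
  have "(t \<otimes> s) \<odot>\<^bsub>M\<^esub> x \<in> K"
    using submodule_smult[OF K t(1) s(3)] t s x by (simp add: smult_assoc1)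
  from submodule_add[OF K Ix[OF t(2)] this] show ?thesis
    using smult_split[of "t \<otimes> s" x] t s x by simp
qed

lemma submodule_Union_chain:
  assumes "C \<noteq> {}" "\<And>N. N \<in> C \<Longrightarrow> submodule R N M"
    and chain: "\<And>N K. N \<in> C \<Longrightarrow> K \<in> C \<Longrightarrow> N \<subseteq> K \<or> K \<subseteq> N"
  shows "submodule R (\<Union>C) M"
proof (rule submoduleI')
  note S = submodule_simps[OF assms(2)]
  show "\<Union>C \<subseteq> carrier M" using S(1) by blast
  show "\<zero>\<^bsub>M\<^esub> \<in> \<Union>C" using S(2) assms(1) by blast
  show "r \<odot>\<^bsub>M\<^esub> x \<in> \<Union>C" if "r \<in> carrier R" "x \<in> \<Union>C" for r x
    using that S(4) by blast
  show "x \<oplus>\<^bsub>M\<^esub> y \<in> \<Union>C" if xy: "x \<in> \<Union>C" "y \<in> \<Union>C" for x y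
  proof -
    obtain N K where "N \<in> C" "K \<in> C" "x \<in> N" "y \<in> K" using xy by blast
    then show ?thesis using chain[of N K] S(3)[of N x y] S(3)[of K x y] by blast
  qed
qed

text \<open>
  A submodule between \<open>A\<close> and \<open>B\<close> that is maximal among those avoiding \<open>y\<close> is a hyperplane of the
  \<open>R/I\<close>-vector space \<open>B/A\<close>, hence together with \<open>y\<close> it generates \<open>B\<close>.
\<close>

lemma exists_hyperplane_avoiding:
  assumes I: "maximalideal I R" and A: "submodule R A M" and B: "submodule R B M" and "A \<subseteq> B"
    and IB: "\<And>r b. r \<in> I \<Longrightarrow> b \<in> B \<Longrightarrow> r \<odot>\<^bsub>M\<^esub> b \<in> A"
    and y: "y \<in> B" "y \<notin> A"
  shows "\<exists>W. submodule R W M \<and> A \<subseteq> W \<and> y \<notin> W \<and> adjoin W y = B"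
proof -
  let ?P = "{W. submodule R W M \<and> A \<subseteq> W \<and> W \<subseteq> B \<and> y \<notin> W}"
  have "\<exists>W\<in>?P. \<forall>X\<in>?P. W \<subseteq> X \<longrightarrow> X = W"
  proof (rule subset_Zorn_nonempty)
    show "?P \<noteq> {}" using A \<open>A \<subseteq> B\<close> y by blast
    fix C assume C: "C \<noteq> {}" "subset.chain ?P C"
    then have "submodule R (\<Union>C) M"
      by (intro submodule_Union_chain) (auto simp: subset_chain_def)
    with C show "\<Union>C \<in> ?P" by (auto simp: subset_chain_def)
  qed
  then obtain W where W: "submodule R W M" "A \<subseteq> W" "W \<subseteq> B" "y \<notin> W"
    and max: "\<And>X. \<lbrakk>submodule R X M; X \<subseteq> B; y \<notin> X; W \<subseteq> X\<rbrakk> \<Longrightarrow> X = W"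
    by auto
  have yM: "y \<in> carrier M" using submodule_carrier[OF B y(1)] .
  note K = adjoin_submodule[OF W(1) yM] subset_adjoin[OF W(1) yM] mem_adjoin[OF W(1) yM]
  have "b \<in> adjoin W y" if b: "b \<in> B" for b
  proof (cases "b \<in> W")
    case True
    then show ?thesis using K(2) by blast
  next
    case False
    have bM: "b \<in> carrier M" using submodule_carrier[OF B b] .
    have "y \<in> adjoin W b"
      using max[OF adjoin_submodule[OF W(1) bM] adjoin_subset[OF B W(3) b]]
        subset_adjoin[OF W(1) bM] mem_adjoin[OF W(1) bM] False by blast
    then obtain w s where ws: "w \<in> W" "s \<in> carrier R" "y = w \<oplus>\<^bsub>M\<^esub> s \<odot>\<^bsub>M\<^esub> b"
      by (auto simp: adjoin_def)
    then have "s \<odot>\<^bsub>M\<^esub> b \<in> adjoin W y"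
      using submodule_add_iff'[OF K(1), of w "s \<odot>\<^bsub>M\<^esub> b"] K bM by auto
    moreover have "s \<notin> I"
      using ws IB[OF _ b] W(2,4) submodule_add[OF W(1), of w "s \<odot>\<^bsub>M\<^esub> b"] by blast
    ultimately show ?thesis
      using mem_if_unit_smult_mem[OF I K(1) bM _ ws(2)] IB[OF _ b] W(2) K(2) by blast
  qed
  moreover have "adjoin W y \<subseteq> B" by (rule adjoin_subset[OF B W(3) y(1)])
  ultimately show ?thesis using W by blast
qed

text \<open>
  \<open>M/W\<close> is a plane over \<open>R/I\<close> with basis \<open>x\<close>, \<open>y\<close>, and \<open>H/W\<close> is the line spanned by \<open>y\<close>. That the fibre is
  not spanned by \<open>x\<close> alone is what makes \<open>H\<close> strictly larger than \<open>I M\<close>.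
\<close>

lemma exists_plane_basis:
  assumes "I \<in> large_fibres R M"
  obtains W H x y where "submodule R W M" "submodule R H M" "ideal_smult R M I \<subseteq> W"
    "W \<subseteq> H" "x \<in> carrier M" "x \<notin> H" "y \<in> H" "y \<notin> W" "adjoin H x = carrier M" "adjoin W y = H"
proof -
  let ?N = "ideal_smult R M I"
  have I: "maximalideal I R" and large: "\<And>x. x \<in> carrier M \<Longrightarrow> adjoin ?N x \<noteq> carrier M"
    using assms large_fibres_iff by auto
  interpret I: maximalideal I R by (rule I)
  note N = ideal_smult_submodule[OF I.ideal_axioms]
  note IN = smult_mem_ideal_smult[OF I.ideal_axioms]
  have "?N \<noteq> carrier M"
    using large[of "\<zero>\<^bsub>M\<^esub>"] subset_adjoin[OF N] submodule_carrier[OF adjoin_submodule[OF N]]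
    by fastforce
  then obtain x where x: "x \<in> carrier M" "x \<notin> ?N" using submodule_carrier[OF N] by blast
  obtain H where H: "submodule R H M" "?N \<subseteq> H" "x \<notin> H" "adjoin H x = carrier M"
    using exists_hyperplane_avoiding[OF I N submodule_carrier_self _ IN x] submodule_carrier[OF N]
    by blast
  have "H \<noteq> ?N" using large[OF x(1)] H(4) by blast
  then obtain y where y: "y \<in> H" "y \<notin> ?N" using H(2) by blast
  obtain W where W: "submodule R W M" "?N \<subseteq> W" "y \<notin> W" "adjoin W y = H"
    using exists_hyperplane_avoiding[OF I N H(1,2) _ y] IN submodule_carrier[OF H(1)] by blast
  have "W \<subseteq> H" using subset_adjoin[OF W(1) submodule_carrier[OF H(1) y(1)]] W(4) by blast
  with H W x y show ?thesis by (intro that[of W H x y])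
qed

text \<open>
  The lines of the plane \<open>M/W\<close> are \<open>H/W\<close>, spanned by \<open>y\<close>, and those spanned by \<open>x + c y\<close>, where \<open>c\<close> runs
  through representatives of \<open>R/I\<close>. A vector \<open>r x + s y\<close> lies on \<open>H/W\<close> if \<open>r\<close> is in \<open>I\<close>, and otherwise on
  the line with slope \<open>c = s/r\<close> modulo \<open>I\<close>.
\<close>

lemma exists_covering_by_lines:
  assumes "I \<in> large_fibres R M"
  shows "\<exists>C. covering R M C \<and> |C| \<le>o |carrier (R Quot I)| +c cone"
proof -
  obtain W H x y where W: "submodule R W M" and H: "submodule R H M"
    and IW: "ideal_smult R M I \<subseteq> W" and "W \<subseteq> H" and x: "x \<in> carrier M" "x \<notin> H"
    and y: "y \<in> H" "y \<notin> W" and adj: "adjoin H x = carrier M" "adjoin W y = H"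
    using exists_plane_basis[OF assms] by blast
  have I: "maximalideal I R" using assms large_fibres_iff by auto
  interpret I: maximalideal I R by (rule I)
  have A: "additive_subgroup I R" by (rule I.additive_subgroup_axioms)
  have Ismult: "r \<odot>\<^bsub>M\<^esub> z \<in> W" if "r \<in> I" "z \<in> carrier M" for r z
    using smult_mem_ideal_smult[OF I.ideal_axioms that] IW by blast
  have yM: "y \<in> carrier M" using submodule_carrier[OF H y(1)] .
  let ?line = "\<lambda>c. adjoin W (x \<oplus>\<^bsub>M\<^esub> c \<odot>\<^bsub>M\<^esub> y)"
  define rep where "rep X = (SOME c. c \<in> X)" for X :: "'a set"
  have rep: "rep (I +> a) \<in> carrier R" "rep (I +> a) \<ominus> a \<in> I" if "a \<in> carrier R" for a
  proof -
    have "a \<in> I +> a" using R.mem_a_r_coset_iff[OF A that that] that by (simp add: R.minus_eq R.r_neg)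
    then have mem: "rep (I +> a) \<in> I +> a" unfolding rep_def by (rule someI)
    then show "rep (I +> a) \<in> carrier R"
      using R.a_r_coset_subset_G[of I a] that I.Icarr by blast
    then show "rep (I +> a) \<ominus> a \<in> I" using mem R.mem_a_r_coset_iff[OF A _ that] by blast
  qed
  define C where "C = insert H ((\<lambda>X. ?line (rep X)) ` carrier (R Quot I))"
  have "covering R M C"
    unfolding covering_def
  proof (intro conjI ballI)
    fix N assume "N \<in> C"
    then consider "N = H" | a where "a \<in> carrier R" "N = ?line (rep (I +> a))"
      by (auto simp: C_def carrier_factor_ring)
    then show "submodule R N M" "N \<noteq> carrier M"
    proof (atomize (full), cases)
      case 1
      then show "submodule R N M \<and> N \<noteq> carrier M" using H x by blast
    next
      case 2
      define c where "c = rep (I +> a)"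
      have c: "c \<in> carrier R" using rep 2 by (simp add: c_def)
      then have z: "x \<oplus>\<^bsub>M\<^esub> c \<odot>\<^bsub>M\<^esub> y \<in> carrier M" using x yM by simp
      \<comment> \<open>If \<open>y\<close> were on the line spanned by \<open>x + c y\<close>, that line would be \<open>H/W\<close>, and \<open>x\<close> would lie in \<open>H\<close>.\<close>
      have "y \<notin> ?line c"
      proof
        assume "y \<in> ?line c"
        then obtain w r where wr: "w \<in> W" "r \<in> carrier R"
            "y = w \<oplus>\<^bsub>M\<^esub> r \<odot>\<^bsub>M\<^esub> (x \<oplus>\<^bsub>M\<^esub> c \<odot>\<^bsub>M\<^esub> y)"
          by (auto simp: adjoin_def)
        then have "r \<notin> I" using Ismult[OF _ z] submodule_add[OF W] y(2) by metis
        moreover have "r \<odot>\<^bsub>M\<^esub> (x \<oplus>\<^bsub>M\<^esub> c \<odot>\<^bsub>M\<^esub> y) \<in> H"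
          using submodule_add_iff'[OF H, of w] wr z y(1) \<open>W \<subseteq> H\<close> smult_closed by (metis subsetD)
        ultimately have "x \<oplus>\<^bsub>M\<^esub> c \<odot>\<^bsub>M\<^esub> y \<in> H"
          using mem_if_unit_smult_mem[OF I H z _ wr(2)] Ismult[OF _ z] \<open>W \<subseteq> H\<close> by blast
        then show False
          using submodule_add_iff[OF H] submodule_smult[OF H c y(1)] x by blast
      qed
      then show "submodule R N M \<and> N \<noteq> carrier M"
        using 2 adjoin_submodule[OF W z] yM unfolding c_def by blast
    qed
  next
    have "z \<in> \<Union>C" if z: "z \<in> carrier M" for z
    proof -
      obtain h r where hr: "h \<in> H" "r \<in> carrier R" "z = h \<oplus>\<^bsub>M\<^esub> r \<odot>\<^bsub>M\<^esub> x"
        using z unfolding adj(1)[symmetric] adjoin_def by blast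
      obtain w s where ws: "w \<in> W" "s \<in> carrier R" "h = w \<oplus>\<^bsub>M\<^esub> s \<odot>\<^bsub>M\<^esub> y"
        using hr(1) unfolding adj(2)[symmetric] adjoin_def by blast
      show ?thesis
      proof (cases "r \<in> I")
        case True
        then have "z \<in> H"
          using hr Ismult[OF True x(1)] \<open>W \<subseteq> H\<close> submodule_add[OF H] by blast
        then show ?thesis by (auto simp: C_def)
      next
        case False
        then obtain t where t: "t \<in> carrier R" "\<one> \<ominus> t \<otimes> r \<in> I"
          using R.maximalideal_unit_mod[OF I hr(2)] by blast
        \<comment> \<open>\<open>t\<close> inverts \<open>r\<close> modulo \<open>I\<close>, so \<open>c\<close> represents \<open>s/r\<close>.\<close>
        define c where "c = rep (I +> (t \<otimes> s))"
        have c: "c \<in> carrier R" "c \<ominus> t \<otimes> s \<in> I"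
          using rep[of "t \<otimes> s"] t ws by (simp_all add: c_def)
        have u: "x \<oplus>\<^bsub>M\<^esub> c \<odot>\<^bsub>M\<^esub> y \<in> carrier M" using x yM c by simp
        note K = adjoin_submodule[OF W u] subset_adjoin[OF W u] mem_adjoin[OF W u]
        have "s \<ominus> r \<otimes> c = (\<one> \<ominus> t \<otimes> r) \<otimes> s \<ominus> r \<otimes> (c \<ominus> t \<otimes> s)"
          using t hr ws c by algebra
        moreover have "(\<one> \<ominus> t \<otimes> r) \<otimes> s \<in> I" "r \<otimes> (c \<ominus> t \<otimes> s) \<in> I"
          using t c ws hr by (simp_all add: I.I_l_closed I.I_r_closed)
        ultimately have "s \<ominus> r \<otimes> c \<in> I" by (simp add: R.minus_eq)
        then have "(s \<ominus> r \<otimes> c) \<odot>\<^bsub>M\<^esub> y \<in> ?line c" using Ismult yM K(2) by blast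
        moreover have "r \<odot>\<^bsub>M\<^esub> (x \<oplus>\<^bsub>M\<^esub> c \<odot>\<^bsub>M\<^esub> y) \<in> ?line c"
          using submodule_smult[OF K(1) hr(2) K(3)] .
        ultimately have "w \<oplus>\<^bsub>M\<^esub> ((s \<ominus> r \<otimes> c) \<odot>\<^bsub>M\<^esub> y \<oplus>\<^bsub>M\<^esub> r \<odot>\<^bsub>M\<^esub> (x \<oplus>\<^bsub>M\<^esub> c \<odot>\<^bsub>M\<^esub> y)) \<in> ?line c"
          using submodule_add[OF K(1)] K(2) ws(1) by blast
        moreover have "w \<oplus>\<^bsub>M\<^esub> ((s \<ominus> r \<otimes> c) \<odot>\<^bsub>M\<^esub> y \<oplus>\<^bsub>M\<^esub> r \<odot>\<^bsub>M\<^esub> (x \<oplus>\<^bsub>M\<^esub> c \<odot>\<^bsub>M\<^esub> y)) = z"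
        proof -
          have "s = (s \<ominus> r \<otimes> c) \<oplus> r \<otimes> c" using hr ws c by algebra
          then have "s \<odot>\<^bsub>M\<^esub> y = (s \<ominus> r \<otimes> c) \<odot>\<^bsub>M\<^esub> y \<oplus>\<^bsub>M\<^esub> r \<odot>\<^bsub>M\<^esub> (c \<odot>\<^bsub>M\<^esub> y)"
            using hr ws c yM by (metis R.m_closed R.minus_closed smult_assoc1 smult_l_distr)
          then show ?thesis
            using hr ws c x yM submodule_carrier[OF W ws(1)]
            by (simp add: smult_r_distr M.a_ac)
        qed
        ultimately have "z \<in> ?line c" by simp
        moreover have "?line c \<in> C"
          using t ws unfolding C_def c_def carrier_factor_ring by blast
        ultimately show ?thesis by blast
      qed
    qed
    moreover have "H \<subseteq> carrier M" using submodule_carrier[OF H] by blast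
    moreover have "?line (rep X) \<subseteq> carrier M" if "X \<in> carrier (R Quot I)" for X
    proof -
      have "x \<oplus>\<^bsub>M\<^esub> rep X \<odot>\<^bsub>M\<^esub> y \<in> carrier M"
      proof -
        obtain a where "a \<in> carrier R" "X = I +> a"
          using \<open>X \<in> carrier (R Quot I)\<close> unfolding carrier_factor_ring by blast
        then show ?thesis using rep(1) x yM by simp
      qed
      then show ?thesis using submodule_carrier[OF adjoin_submodule[OF W]] by blast
    qed
    ultimately have "carrier M \<subseteq> \<Union>C" "\<Union>C \<subseteq> carrier M" unfolding C_def by blast+
    then show "\<Union>C = carrier M" by blast
  qed
  moreover have "|C| \<le>o |carrier (R Quot I)| +c cone"
  proof -
    let ?f = "case_sum (\<lambda>X. ?line (rep X)) (\<lambda>_::unit. H)"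
    have "C = ?f ` (carrier (R Quot I) <+> {()})"
      by (auto simp: C_def Plus_def image_Un image_image)
    then have "|C| \<le>o |carrier (R Quot I) <+> {()}|" by (simp only: card_of_image)
    then show ?thesis by (simp add: csum_def cone_def Field_card_of)
  qed
  ultimately show ?thesis by blast
qed

end

section \<open>Irredundant coverings by maximal submodules\<close>

lemma (in cring) maximalidealI_unit_mod:
  assumes I: "ideal I R" and "\<one> \<notin> I"
    and unit: "\<And>r. r \<in> carrier R \<Longrightarrow> r \<notin> I \<Longrightarrow> \<exists>s\<in>carrier R. \<one> \<ominus> s \<otimes> r \<in> I"
  shows "maximalideal I R"
proof (rule maximalidealI[OF I])
  show "carrier R \<noteq> I" using assms(2) one_closed by blast
  fix J assume J: "ideal J R" "I \<subseteq> J" "J \<subseteq> carrier R"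
  interpret J: ideal J R by (rule J)
  show "J = I \<or> J = carrier R"
  proof (rule disjCI)
    assume "J \<noteq> carrier R"
    show "J = I"
    proof (rule ccontr)
      assume "J \<noteq> I"
      then obtain r where r: "r \<in> J" "r \<notin> I" using J by blast
      have rR: "r \<in> carrier R" using r J by blast
      obtain s where s: "s \<in> carrier R" "\<one> \<ominus> s \<otimes> r \<in> I" using unit[OF rR r(2)] by blast
      have "(\<one> \<ominus> s \<otimes> r) \<oplus> s \<otimes> r \<in> J"
        using s r J(2) J.I_l_closed by blast
      moreover have "(\<one> \<ominus> s \<otimes> r) \<oplus> s \<otimes> r = \<one>"
        using s rR by (simp add: minus_eq a_assoc l_neg)
      ultimately show False using J.one_imp_carrier \<open>J \<noteq> carrier R\<close> by simp
    qed
  qed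
qed

text \<open>
  The Chinese remainder theorem for the two ideals \<open>I\<close> and \<open>\<Inter>JJ\<close>: for each \<open>J\<close> in \<open>JJ\<close> some element of \<open>J\<close>
  is congruent to \<open>1\<close> modulo \<open>I\<close>, and \<open>e\<close> is the product of these elements.
\<close>

lemma (in cring) exists_idempotent_mod_maximalideals:
  assumes I: "maximalideal I R" and "finite JJ"
    and "\<And>J. J \<in> JJ \<Longrightarrow> maximalideal J R" "I \<notin> JJ"
  shows "\<exists>e\<in>carrier R. \<one> \<ominus> e \<in> I \<and> (\<forall>J\<in>JJ. e \<in> J)"
  using assms(2-)
proof (induction JJ rule: finite_induct)
  case empty
  interpret I: maximalideal I R by (rule I)
  show ?case by (intro bexI[of _ \<one>]) (simp_all add: minus_eq r_neg)
next
  case (insert J JJ)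
  interpret I: maximalideal I R by (rule I)
  interpret J: maximalideal J R using insert.prems by simp
  obtain e where e: "e \<in> carrier R" "\<one> \<ominus> e \<in> I" "\<And>K. K \<in> JJ \<Longrightarrow> e \<in> K"
    using insert.IH insert.prems by auto
  have "\<not> J \<subseteq> I"
  proof
    assume "J \<subseteq> I"
    then have "I = J \<or> I = carrier R"
      by (intro J.I_maximal I.ideal_axioms I.a_subset)
    then show False using I.I_notcarr insert.prems by auto
  qed
  then obtain j where j: "j \<in> J" "j \<notin> I" by blast
  obtain s where s: "s \<in> carrier R" "\<one> \<ominus> s \<otimes> j \<in> I"
    using maximalideal_unit_mod[OF I J.Icarr[OF j(1)] j(2)] by blast
  have jR: "j \<in> carrier R" using j J.Icarr by blast
  have "e \<otimes> (s \<otimes> j) \<in> K" if "K \<in> insert J JJ" for K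
  proof (cases "K = J")
    case True
    then show ?thesis using e s j by (simp add: J.I_l_closed)
  next
    case False
    then interpret K: maximalideal K R using that insert.prems by simp
    show ?thesis using False that e s jR by (simp add: K.I_r_closed)
  qed
  moreover have "\<one> \<ominus> e \<otimes> (s \<otimes> j) = (\<one> \<ominus> e) \<oplus> e \<otimes> (\<one> \<ominus> s \<otimes> j)"
    using e s jR by algebra
  then have "\<one> \<ominus> e \<otimes> (s \<otimes> j) \<in> I"
    using e s by (simp add: I.I_l_closed)
  ultimately show ?case using e s jR by (intro bexI[of _ "e \<otimes> (s \<otimes> j)"]) auto
qed

lemma coveringD:
  assumes "covering R M C"
  shows "N \<in> C \<Longrightarrow> submodule R N M" "N \<in> C \<Longrightarrow> N \<noteq> carrier M" "\<Union>C = carrier M"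
  using assms by (simp_all add: covering_def)

context module
begin

definition maximal_submodule :: "'c set \<Rightarrow> bool"
  where "maximal_submodule L \<longleftrightarrow> submodule R L M \<and> L \<noteq> carrier M \<and>
    (\<forall>K. submodule R K M \<and> L \<subseteq> K \<and> K \<noteq> carrier M \<longrightarrow> K = L)"

definition quotient_annihilator :: "'c set \<Rightarrow> 'a set"
  where "quotient_annihilator L = {r \<in> carrier R. \<forall>x\<in>carrier M. r \<odot>\<^bsub>M\<^esub> x \<in> L}"

lemma adjoin_maximal_submodule:
  assumes "maximal_submodule L" "x \<in> carrier M" "x \<notin> L"
  shows "adjoin L x = carrier M"
  using assms adjoin[of L x] unfolding maximal_submodule_def by blast

text \<open>
  \<open>M/L\<close> is simple, so every nonzero vector generates it; what kills one of them kills all.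
\<close>

lemma mem_quotient_annihilator_if_smult_mem:
  assumes L: "maximal_submodule L" and x: "x \<in> carrier M" "x \<notin> L"
    and r: "r \<in> carrier R" "r \<odot>\<^bsub>M\<^esub> x \<in> L"
  shows "r \<in> quotient_annihilator L"
proof -
  have sub: "submodule R L M" using L by (simp add: maximal_submodule_def)
  have "r \<odot>\<^bsub>M\<^esub> z \<in> L" if z: "z \<in> carrier M" for z
  proof -
    obtain l t where lt: "l \<in> L" "t \<in> carrier R" "z = l \<oplus>\<^bsub>M\<^esub> t \<odot>\<^bsub>M\<^esub> x"
      using z unfolding adjoin_maximal_submodule[OF L x, symmetric] adjoin_def by blast
    have "r \<odot>\<^bsub>M\<^esub> z = r \<odot>\<^bsub>M\<^esub> l \<oplus>\<^bsub>M\<^esub> t \<odot>\<^bsub>M\<^esub> (r \<odot>\<^bsub>M\<^esub> x)"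
      using lt r x submodule_carrier[OF sub lt(1)]
      by (simp add: smult_r_distr smult_assoc1[symmetric] R.m_comm)
    then show ?thesis
      using submodule_add[OF sub] submodule_smult[OF sub] lt r by simp
  qed
  then show ?thesis using r by (simp add: quotient_annihilator_def)
qed

text \<open>
  If \<open>r\<close> does not annihilate \<open>M/L\<close>, then some \<open>r x\<close> is not in \<open>L\<close> and generates \<open>M/L\<close>. Thus
  \<open>x = s r x\<close> modulo \<open>L\<close> for some \<open>s\<close>, and \<open>1 - s r\<close> kills the generator \<open>x\<close> of \<open>M/L\<close>.
\<close>

lemma maximalideal_quotient_annihilator:
  assumes L: "maximal_submodule L"
  shows "maximalideal (quotient_annihilator L) R"
proof (rule R.maximalidealI_unit_mod)
  let ?I = "quotient_annihilator L"
  have sub: "submodule R L M" using L by (simp add: maximal_submodule_def)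
  note S = submodule_simps[OF sub]
  show "ideal ?I R"
  proof (rule idealI)
    show "ring R" by (rule R.ring_axioms)
    show "subgroup ?I (add_monoid R)"
    proof (rule R.add.subgroupI)
      have "\<zero> \<in> ?I" using S(2) by (simp add: quotient_annihilator_def)
      then show "?I \<noteq> {}" by blast
    qed (use S in \<open>auto simp: quotient_annihilator_def smult_l_minus smult_l_distr\<close>)
    show "x \<otimes> a \<in> ?I" if "a \<in> ?I" "x \<in> carrier R" for a x
      using that S(4) by (simp add: quotient_annihilator_def smult_assoc1)
    show "a \<otimes> x \<in> ?I" if "a \<in> ?I" "x \<in> carrier R" for a x
      using that S(4) by (simp add: quotient_annihilator_def smult_assoc1)
  qed
  show "\<one> \<notin> ?I"
    using L S(1) by (auto simp: quotient_annihilator_def maximal_submodule_def)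
  show "\<exists>s\<in>carrier R. \<one> \<ominus> s \<otimes> r \<in> ?I" if r: "r \<in> carrier R" "r \<notin> ?I" for r
  proof -
    obtain x where x: "x \<in> carrier M" "r \<odot>\<^bsub>M\<^esub> x \<notin> L"
      using r by (auto simp: quotient_annihilator_def)
    have "x \<in> adjoin L (r \<odot>\<^bsub>M\<^esub> x)"
      using adjoin_maximal_submodule[OF L _ x(2)] r x by simp
    then obtain l s where ls: "l \<in> L" "s \<in> carrier R" "x = l \<oplus>\<^bsub>M\<^esub> s \<odot>\<^bsub>M\<^esub> (r \<odot>\<^bsub>M\<^esub> x)"
      unfolding adjoin_def by blast
    have "(\<one> \<ominus> s \<otimes> r) \<odot>\<^bsub>M\<^esub> x = x \<ominus>\<^bsub>M\<^esub> s \<odot>\<^bsub>M\<^esub> (r \<odot>\<^bsub>M\<^esub> x)"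
      using ls r x by (simp add: R.minus_eq M.minus_eq smult_l_distr smult_l_minus smult_assoc1)
    also have "\<dots> = (l \<oplus>\<^bsub>M\<^esub> s \<odot>\<^bsub>M\<^esub> (r \<odot>\<^bsub>M\<^esub> x)) \<ominus>\<^bsub>M\<^esub> s \<odot>\<^bsub>M\<^esub> (r \<odot>\<^bsub>M\<^esub> x)"
      using ls(3) by simp
    also have "\<dots> = l"
      using ls(1,2) S(1) r x by (simp add: M.minus_eq M.a_assoc M.r_neg)
    finally have "(\<one> \<ominus> s \<otimes> r) \<odot>\<^bsub>M\<^esub> x \<in> L" using ls by simp
    moreover have "x \<notin> L" using x S(4) r by blast
    ultimately have "\<one> \<ominus> s \<otimes> r \<in> ?I"
      using mem_quotient_annihilator_if_smult_mem[OF L] x ls r by simp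
    then show ?thesis using ls by blast
  qed
qed

text \<open>
  An overmodule of \<open>N\<close> is a union of cosets of \<open>N\<close>.
\<close>

lemma finite_overmodules:
  assumes N: "submodule R N M" and fin: "finite (a_rcosets\<^bsub>M\<^esub> N)"
  shows "finite {K. submodule R K M \<and> N \<subseteq> K}"
proof (rule finite_subset)
  show "{K. submodule R K M \<and> N \<subseteq> K} \<subseteq> Union ` Pow (a_rcosets\<^bsub>M\<^esub> N)"
  proof
    fix K assume "K \<in> {K. submodule R K M \<and> N \<subseteq> K}"
    then have K: "submodule R K M" "N \<subseteq> K" by auto
    note S = submodule_simps[OF K(1)]
    have "x \<in> N +>\<^bsub>M\<^esub> x" if "x \<in> K" for x
      using M.mem_a_r_coset_iff[OF submodule_additive_subgroup[OF N], of x x] S(1)[OF that]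
        submodule_zero[OF N] by (simp add: M.minus_eq M.r_neg)
    moreover have "N +>\<^bsub>M\<^esub> x \<subseteq> K" if "x \<in> K" for x
      using that K(2) S(3) by (auto simp: a_r_coset_def')
    ultimately have "K = \<Union>((\<lambda>x. N +>\<^bsub>M\<^esub> x) ` K)" by blast
    moreover have "(\<lambda>x. N +>\<^bsub>M\<^esub> x) ` K \<subseteq> a_rcosets\<^bsub>M\<^esub> N"
      using S(1) by (auto simp: A_RCOSETS_def')
    ultimately show "K \<in> Union ` Pow (a_rcosets\<^bsub>M\<^esub> N)" by blast
  qed
qed (use fin in simp)

lemma exists_maximal_submodule_above:
  assumes N: "submodule R N M" "N \<noteq> carrier M" and fin: "finite (a_rcosets\<^bsub>M\<^esub> N)"
  shows "\<exists>L. maximal_submodule L \<and> N \<subseteq> L"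
proof -
  let ?P = "{K. submodule R K M \<and> N \<subseteq> K} - {carrier M}"
  have "finite ?P" using finite_overmodules[OF N(1) fin] by simp
  then obtain L where L: "L \<in> ?P" "N \<subseteq> L" "\<And>K. K \<in> ?P \<Longrightarrow> L \<subseteq> K \<Longrightarrow> L = K"
    using finite_has_maximal2[of ?P N] N by auto
  then have "maximal_submodule L" unfolding maximal_submodule_def by blast
  with L show ?thesis by blast
qed

text \<open>
  Let \<open>I\<close> be the annihilator belonging to \<open>L\<close>, and suppose that the members that share it form a proper part \<open>B\<close> of the covering. By
  irredundance some \<open>x\<close> escapes \<open>B\<close> and some \<open>y\<close> escapes the other members. An element \<open>e\<close> of \<open>R\<close> that is
  \<open>1\<close> modulo \<open>I\<close> and \<open>0\<close> modulo the remaining annihilators combines them: \<open>e x + (1 - e) y\<close> is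
  congruent to \<open>x\<close> modulo each member of \<open>B\<close> and to \<open>y\<close> modulo every other member, so it escapes them
  all.
\<close>

lemma quotient_annihilators_agree:
  assumes fin: "finite C" and cov: "covering R M C" and irr: "irredundant M C"
    and max: "\<And>L. L \<in> C \<Longrightarrow> maximal_submodule L" and L: "L \<in> C" "K \<in> C"
  shows "quotient_annihilator K = quotient_annihilator L"
proof (rule ccontr)
  assume neq: "quotient_annihilator K \<noteq> quotient_annihilator L"
  let ?I = "quotient_annihilator L"
  define B where "B = {N \<in> C. quotient_annihilator N = ?I}"
  have union: "\<Union>C = carrier M" and sub: "\<And>N. N \<in> C \<Longrightarrow> submodule R N M"
    using cov by (auto simp: covering_def)
  have "B \<subset> C" "C - B \<subset> C" using L neq by (auto simp: B_def)
  then have "\<Union>B \<noteq> carrier M" "\<Union>(C - B) \<noteq> carrier M"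
    using irr unfolding irredundant_def by blast+
  moreover have "\<Union>B \<subseteq> carrier M" "\<Union>(C - B) \<subseteq> carrier M" using union by (auto simp: B_def)
  ultimately obtain x y where x: "x \<in> carrier M" "x \<notin> \<Union>B"
    and y: "y \<in> carrier M" "y \<notin> \<Union>(C - B)" by blast
  have "\<exists>e\<in>carrier R. \<one> \<ominus> e \<in> ?I \<and> (\<forall>J\<in>quotient_annihilator ` (C - B). e \<in> J)"
  proof (rule R.exists_idempotent_mod_maximalideals)
    show "maximalideal ?I R" using max L maximalideal_quotient_annihilator by blast
    show "maximalideal J R" if "J \<in> quotient_annihilator ` (C - B)" for J
      using that max maximalideal_quotient_annihilator by blast
  qed (use fin in \<open>auto simp: B_def\<close>)
  then obtain e where e: "e \<in> carrier R" "\<one> \<ominus> e \<in> ?I"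
    "\<And>N. N \<in> C - B \<Longrightarrow> e \<in> quotient_annihilator N" by blast
  let ?z = "e \<odot>\<^bsub>M\<^esub> x \<oplus>\<^bsub>M\<^esub> (\<one> \<ominus> e) \<odot>\<^bsub>M\<^esub> y"
  have "?z \<in> carrier M" using e x y by simp
  then obtain N where N: "N \<in> C" "?z \<in> N" using union by blast
  note S = submodule_simps[OF sub[OF N(1)]]
  show False
  proof (cases "N \<in> B")
    case True
    then have in_N: "(\<one> \<ominus> e) \<odot>\<^bsub>M\<^esub> u \<in> N" if "u \<in> carrier M" for u
      using e(2) that by (auto simp: B_def quotient_annihilator_def)
    then have "e \<odot>\<^bsub>M\<^esub> x \<in> N" using N(2) S(7)[OF in_N[OF y(1)]] e x by simp
    then have "x \<in> N" using S(3)[OF in_N[OF x(1)]] smult_split[OF e(1) x(1)] by metis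
    then show False using x True by blast
  next
    case False
    then have in_N: "e \<odot>\<^bsub>M\<^esub> u \<in> N" if "u \<in> carrier M" for u
      using e(3)[of N] N that by (auto simp: quotient_annihilator_def)
    then have "(\<one> \<ominus> e) \<odot>\<^bsub>M\<^esub> y \<in> N" using N(2) S(8)[OF in_N[OF x(1)]] e y by simp
    then have "y \<in> N" using S(3)[OF _ in_N[OF y(1)]] smult_split[OF e(1) y(1)] by metis
    then show False using y False N by blast
  qed
qed

text \<open>
  Choose \<open>x\<close> in the member \<open>L\<close> and in no other, and \<open>y\<close> outside \<open>L\<close>. For \<open>c\<close> running through
  representatives of \<open>R/I\<close>, the vectors \<open>y + c x\<close> avoid \<open>L\<close>. If two of them lay in the same member \<open>N\<close>,
  so would a multiple \<open>(a - b) x\<close> with \<open>a - b\<close> not in \<open>I\<close>, whence \<open>x\<close> itself would lie in \<open>N\<close>. So, besides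
  \<open>L\<close>, the covering has a member for each element of \<open>R/I\<close>.
\<close>

lemma irredundant_maximal_covering_bound:
  assumes fin: "finite C" and cov: "covering R M C" and irr: "irredundant M C"
    and max: "\<And>L. L \<in> C \<Longrightarrow> maximal_submodule L"
  shows "\<exists>I\<in>large_fibres R M. |carrier (R Quot I)| +c cone \<le>o |C|"
proof -
  have union: "\<Union>C = carrier M" and sub: "\<And>N. N \<in> C \<Longrightarrow> submodule R N M"
    and proper: "\<And>N. N \<in> C \<Longrightarrow> N \<noteq> carrier M"
    using cov by (auto simp: covering_def)
  obtain L where L: "L \<in> C" using union M.zero_closed by blast
  define I where "I = quotient_annihilator L"
  have ann: "quotient_annihilator N = I" if "N \<in> C" for N
    using quotient_annihilators_agree[OF fin cov irr max L that] by (simp add: I_def)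
  have I: "maximalideal I R"
    unfolding I_def by (rule maximalideal_quotient_annihilator[OF max[OF L]])
  interpret I: maximalideal I R by (rule I)
  have "adjoin (ideal_smult R M I) x \<noteq> carrier M" if x: "x \<in> carrier M" for x
  proof -
    obtain N where N: "N \<in> C" "x \<in> N" using x union by blast
    have "r \<odot>\<^bsub>M\<^esub> u \<in> N" if "r \<in> I" "u \<in> carrier M" for r u
      using that unfolding ann[OF N(1), symmetric] quotient_annihilator_def by simp
    then have "ideal_smult R M I \<subseteq> N" by (rule ideal_smult_subset[OF sub[OF N(1)]])
    then have "adjoin (ideal_smult R M I) x \<subseteq> N" by (rule adjoin_subset[OF sub[OF N(1)] _ N(2)])
    moreover have "N \<subset> carrier M" using proper[OF N(1)] submodule_carrier[OF sub[OF N(1)]] by blast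
    ultimately show ?thesis by blast
  qed
  then have large: "I \<in> large_fibres R M" using I large_fibres_iff by blast
  have "C - {L} \<subset> C" using L by blast
  then have "\<Union>(C - {L}) \<noteq> carrier M" using irr by (auto simp: irredundant_def)
  then obtain x where x: "x \<in> carrier M" "x \<in> L" "\<And>N. N \<in> C - {L} \<Longrightarrow> x \<notin> N"
    using union by blast
  obtain y where y: "y \<in> carrier M" "y \<notin> L"
    using proper[OF L] submodule_carrier[OF sub[OF L]] by blast
  have "\<forall>X\<in>carrier (R Quot I). \<exists>a\<in>carrier R. X = I +> a" by (auto simp: carrier_factor_ring)
  then obtain rep where rep: "\<And>X. X \<in> carrier (R Quot I) \<Longrightarrow> rep X \<in> carrier R \<and> X = I +> rep X"
    by metis
  let ?z = "\<lambda>X. y \<oplus>\<^bsub>M\<^esub> rep X \<odot>\<^bsub>M\<^esub> x"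
  have "\<exists>N\<in>C - {L}. ?z X \<in> N" if X: "X \<in> carrier (R Quot I)" for X
  proof -
    have "?z X \<in> carrier M" using rep[OF X] x y by simp
    moreover have "?z X \<notin> L"
      using submodule_add_iff[OF sub[OF L], of "rep X \<odot>\<^bsub>M\<^esub> x" y]
        submodule_smult[OF sub[OF L]] rep[OF X] x y by simp
    ultimately show ?thesis using union by blast
  qed
  then obtain g where g: "\<And>X. X \<in> carrier (R Quot I) \<Longrightarrow> g X \<in> C - {L} \<and> ?z X \<in> g X"
    by metis
  have inj: "inj_on g (carrier (R Quot I))"
  proof (rule inj_onI)
    fix X Y assume X: "X \<in> carrier (R Quot I)" and Y: "Y \<in> carrier (R Quot I)" and eq: "g X = g Y"
    let ?N = "g X" and ?a = "rep X" and ?b = "rep Y"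
    have N: "?N \<in> C - {L}" "?z X \<in> ?N" "?z Y \<in> ?N" using g[OF X] g[OF Y] eq by simp_all
    have ab: "?a \<in> carrier R" "?b \<in> carrier R" using rep X Y by blast+
    have "?z X \<ominus>\<^bsub>M\<^esub> ?z Y = (?a \<ominus> ?b) \<odot>\<^bsub>M\<^esub> x"
    proof -
      have "?z X \<ominus>\<^bsub>M\<^esub> ?z Y = (\<ominus>\<^bsub>M\<^esub> y \<oplus>\<^bsub>M\<^esub> y) \<oplus>\<^bsub>M\<^esub> (?a \<odot>\<^bsub>M\<^esub> x \<ominus>\<^bsub>M\<^esub> ?b \<odot>\<^bsub>M\<^esub> x)"
        using ab x y by (simp add: M.minus_eq M.minus_add M.a_ac del: M.l_neg M.r_neg)
      then show ?thesis
        using ab x y by (simp add: M.l_neg M.minus_eq R.minus_eq smult_l_distr smult_l_minus)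
    qed
    then have "(?a \<ominus> ?b) \<odot>\<^bsub>M\<^esub> x \<in> ?N"
      using submodule_diff[OF sub N(2,3)] N(1) by simp
    moreover have "x \<notin> ?N" using x N by blast
    ultimately have "?a \<ominus> ?b \<in> quotient_annihilator ?N"
      using N(1) ab x(1) by (intro mem_quotient_annihilator_if_smult_mem[of _ x] max) simp_all
    then have "?a \<ominus> ?b \<in> I" using ann N(1) by blast
    then have "I +> ?a = I +> ?b"
      using R.a_r_coset_eq_iff[OF I.additive_subgroup_axioms] ab by blast
    then show "X = Y" using rep[OF X] rep[OF Y] by simp
  qed
  let ?h = "case_sum g (\<lambda>_::unit. L)"
  have "inj_on ?h (carrier (R Quot I) <+> {()})"
  proof (rule inj_onI)
    fix u v assume uv: "u \<in> carrier (R Quot I) <+> {()}" "v \<in> carrier (R Quot I) <+> {()}"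
      and eq: "?h u = ?h v"
    have "g X \<noteq> L" "L \<noteq> g X" if "X \<in> carrier (R Quot I)" for X using g[OF that] by blast+
    then show "u = v" using uv eq by (cases u; cases v) (auto simp: inj_on_eq_iff[OF inj])
  qed
  moreover have "?h ` (carrier (R Quot I) <+> {()}) \<subseteq> C"
  proof -
    have "g X \<in> C" if "X \<in> carrier (R Quot I)" for X using g[OF that] by blast
    then show ?thesis using L by auto
  qed
  ultimately have "|carrier (R Quot I) <+> {()}| \<le>o |C|"
    by (metis card_of_ordLeq)
  then have "|carrier (R Quot I)| +c cone \<le>o |C|"
    by (simp add: csum_def cone_def Field_card_of)
  with large show ?thesis by blast
qed

section \<open>Finite coverings and finite quotients\<close>

lemma exists_irredundant_subcovering:
  assumes "finite C" "covering R M C"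
  shows "\<exists>D\<subseteq>C. covering R M D \<and> irredundant M D"
proof -
  let ?P = "{D. D \<subseteq> C \<and> \<Union>D = carrier M}"
  have "finite ?P" "C \<in> ?P" using assms by (auto simp: covering_def)
  then obtain D where D: "D \<in> ?P" "\<And>E. E \<in> ?P \<Longrightarrow> E \<subseteq> D \<Longrightarrow> D = E"
    using finite_has_minimal2[of ?P C] by auto
  then have "irredundant M D" unfolding irredundant_def by blast
  moreover have "covering R M D" using D assms by (auto simp: covering_def)
  ultimately show ?thesis using D by blast
qed

lemma finite_index_if_irredundant_covering:
  assumes "finite C" "covering R M C" "irredundant M C" "N \<in> C"
  shows "finite (a_rcosets\<^bsub>M\<^esub> N)"
  using assms submodule_additive_subgroup
  by (intro M.finite_index_if_irredundant_cover[of C]) (auto simp: covering_def irredundant_def)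

text \<open>
  Irredundance is arranged twice: first to know that the members have finite index, which provides
  maximal submodules above them, and then again because enlarging the members may destroy it.
\<close>

lemma finite_covering_bound:
  assumes "finite C" "covering R M C"
  shows "\<exists>I\<in>large_fibres R M. |carrier (R Quot I)| +c cone \<le>o |C|"
proof -
  obtain D where D: "D \<subseteq> C" "covering R M D" "irredundant M D"
    using exists_irredundant_subcovering[OF assms] by blast
  have finD: "finite D" using D assms finite_subset by blast
  have "\<exists>L. maximal_submodule L \<and> N \<subseteq> L" if N: "N \<in> D" for N
  proof (rule exists_maximal_submodule_above)
    show "submodule R N M" "N \<noteq> carrier M" using D(2) N by (auto simp: covering_def)
    show "finite (a_rcosets\<^bsub>M\<^esub> N)"
      by (rule finite_index_if_irredundant_covering[OF finD D(2,3) N])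
  qed
  then obtain top where top: "\<And>N. N \<in> D \<Longrightarrow> maximal_submodule (top N) \<and> N \<subseteq> top N"
    by metis
  have max_carrier: "L \<subseteq> carrier M" if "maximal_submodule L" for L
    using that submodule_carrier unfolding maximal_submodule_def by blast
  have "covering R M (top ` D)"
    unfolding covering_def
  proof (intro conjI ballI)
    show "submodule R L M" "L \<noteq> carrier M" if "L \<in> top ` D" for L
      using that top unfolding maximal_submodule_def by blast+
    have "\<Union>D \<subseteq> \<Union>(top ` D)" using top by blast
    moreover have "\<Union>(top ` D) \<subseteq> carrier M" using top max_carrier by blast
    ultimately show "\<Union>(top ` D) = carrier M" using D(2) by (auto simp: covering_def)
  qed
  then obtain E where E: "E \<subseteq> top ` D" "covering R M E" "irredundant M E"
    using exists_irredundant_subcovering[of "top ` D"] finD by blast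
  have "finite E" using E finD finite_surj by blast
  then obtain I where I: "I \<in> large_fibres R M" "|carrier (R Quot I)| +c cone \<le>o |E|"
    using irredundant_maximal_covering_bound[OF _ E(2,3)] E(1) top by blast
  have "|E| \<le>o |D|" using E(1) card_of_mono1 card_of_image ordLeq_transitive by metis
  also have "|D| \<le>o |C|" using D(1) by (rule card_of_mono1)
  finally show ?thesis using I ordLeq_transitive by blast
qed

lemma mem_image_coset_iff:
  assumes N: "submodule R N M" and L: "submodule R L M" "N \<subseteq> L" and x: "x \<in> carrier M"
  shows "N +>\<^bsub>M\<^esub> x \<in> (\<lambda>x. N +>\<^bsub>M\<^esub> x) ` L \<longleftrightarrow> x \<in> L"
proof
  assume "N +>\<^bsub>M\<^esub> x \<in> (\<lambda>x. N +>\<^bsub>M\<^esub> x) ` L"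
  then obtain l where l: "l \<in> L" "N +>\<^bsub>M\<^esub> x = N +>\<^bsub>M\<^esub> l" by blast
  then have "x \<ominus>\<^bsub>M\<^esub> l \<in> L"
    using M.a_r_coset_eq_iff[OF submodule_additive_subgroup[OF N] x] submodule_carrier[OF L(1)] L(2)
    by blast
  then show "x \<in> L" using submodule_diff_iff[OF L(1) l(1) x] by blast
qed blast

lemma image_coset_submodule:
  assumes N: "submodule R N M" and L: "submodule R L M"
  shows "submodule R ((\<lambda>x. N +>\<^bsub>M\<^esub> x) ` L) (quot_module M N)"
proof -
  note S = submodule_simps[OF L] and Q = quot_module_simps[OF N]
  interpret Q: module R "quot_module M N" by (rule quot_module_module[OF N])
  show ?thesis
  proof (rule Q.submoduleI')
    show "(\<lambda>x. N +>\<^bsub>M\<^esub> x) ` L \<subseteq> carrier (quot_module M N)" using S(1) Q(1) by blast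
  qed (use S Q in \<open>auto\<close>)
qed

text \<open>
  Members of \<open>C\<close> contain \<open>N\<close>, hence are the preimages of their images in \<open>M/N\<close>.
\<close>

lemma irredundant_covering_lifted:
  assumes C: "finite C" "covering R M C" "irredundant M C"
  defines "N \<equiv> \<Inter>C"
  shows "submodule R N M" and "finite (carrier (quot_module M N))"
    and "\<exists>D. covering R (quot_module M N) D \<and> C = lifted_covering M N D"
proof -
  have union: "\<Union>C = carrier M" and sub: "\<And>L. L \<in> C \<Longrightarrow> submodule R L M"
    and proper: "\<And>L. L \<in> C \<Longrightarrow> L \<noteq> carrier M"
    using C(2) by (auto simp: covering_def)
  have "C \<noteq> {}" using union M.zero_closed by blast
  then have N_eq: "carrier M \<inter> \<Inter>C = N" using union by (auto simp: N_def)
  show N: "submodule R N M"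
  proof (rule submoduleI')
    show "N \<subseteq> carrier M" using N_eq by blast
  qed (use submodule_simps[OF sub] in \<open>simp_all add: N_def\<close>)
  show "finite (carrier (quot_module M N))"
    using M.finite_index_Inter(2)[OF C(1)] finite_index_if_irredundant_covering[OF C]
      submodule_additive_subgroup[OF sub] N_eq by (simp add: quot_module_def)
  let ?\<pi> = "\<lambda>x. N +>\<^bsub>M\<^esub> x"
  let ?D = "(\<lambda>L. ?\<pi> ` L) ` C"
  have mem: "?\<pi> x \<in> ?\<pi> ` L \<longleftrightarrow> x \<in> L" if "L \<in> C" "x \<in> carrier M" for L x
    using mem_image_coset_iff[OF N sub[OF that(1)] _ that(2)] that(1) by (auto simp: N_def)
  have "covering R (quot_module M N) ?D"
    unfolding covering_def
  proof (intro conjI ballI)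
    show "submodule R X (quot_module M N)" if "X \<in> ?D" for X
      using that image_coset_submodule[OF N sub] by blast
    show "X \<noteq> carrier (quot_module M N)" if X: "X \<in> ?D" for X
    proof -
      obtain L where L: "L \<in> C" "X = ?\<pi> ` L" using X by blast
      obtain x where "x \<in> carrier M" "x \<notin> L"
        using proper[OF L(1)] submodule_carrier[OF sub[OF L(1)]] by blast
      then have "?\<pi> x \<in> carrier (quot_module M N)" "?\<pi> x \<notin> X"
        using mem[OF L(1)] L(2) quot_carrier[OF N] by simp_all
      then show ?thesis by blast
    qed
    show "\<Union>?D = carrier (quot_module M N)"
      unfolding quot_carrier[OF N] union[symmetric] by blast
  qed
  moreover have "C = lifted_covering M N ?D"
  proof -
    have "{x \<in> carrier M. ?\<pi> x \<in> ?\<pi> ` L} = L" if "L \<in> C" for L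
      using mem[OF that] submodule_carrier[OF sub[OF that]] by blast
    then show ?thesis by (simp add: lifted_covering_def image_image)
  qed
  ultimately show "\<exists>D. covering R (quot_module M N) D \<and> C = lifted_covering M N D" by blast
qed

text \<open>
  From left to right, a generator of \<open>M/N\<close> would lie in the image of a member of the covering, which
  is proper. From right to left, the submodules \<open>N + R x\<close> cover \<open>M\<close>; they are proper as \<open>M/N\<close> is not
  cyclic, and finite in number as \<open>N\<close> has finite index.
\<close>

lemma finite_covering_iff_finite_noncyclic_quotient:
  "(\<exists>C. finite C \<and> covering R M C) \<longleftrightarrow>
    (\<exists>N. submodule R N M \<and> finite (carrier (quot_module M N))
      \<and> \<not> cyclic_module R (quot_module M N))"
proof
  assume "\<exists>C. finite C \<and> covering R M C"
  then obtain C where C: "finite C" "covering R M C" "irredundant M C"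
    using exists_irredundant_subcovering finite_subset by meson
  have union: "\<Union>C = carrier M" by (rule coveringD(3)[OF C(2)])
  let ?N = "\<Inter>C"
  note N = irredundant_covering_lifted(1,2)[OF C]
  have "adjoin ?N x \<noteq> carrier M" if x: "x \<in> carrier M" for x
  proof -
    obtain L where L: "L \<in> C" "x \<in> L" using x union by blast
    then have sub: "submodule R L M" "L \<noteq> carrier M"
      using coveringD(1,2)[OF C(2) L(1)] by blast+
    have "adjoin ?N x \<subseteq> L" using adjoin_subset[OF sub(1) _ L(2)] L(1) by blast
    moreover have "L \<subset> carrier M" using sub submodule_carrier[OF sub(1)] by blast
    ultimately show ?thesis by blast
  qed
  then show "\<exists>N. submodule R N M \<and> finite (carrier (quot_module M N))
      \<and> \<not> cyclic_module R (quot_module M N)"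
    using N cyclic_quot_module_iff by blast
next
  assume "\<exists>N. submodule R N M \<and> finite (carrier (quot_module M N))
      \<and> \<not> cyclic_module R (quot_module M N)"
  then obtain N where N: "submodule R N M" "finite (carrier (quot_module M N))"
    and adj: "\<And>x. x \<in> carrier M \<Longrightarrow> adjoin N x \<noteq> carrier M"
    using cyclic_quot_module_iff by blast
  let ?C = "adjoin N ` carrier M"
  note K = adjoin[OF N(1)]
  have "finite (a_rcosets\<^bsub>M\<^esub> N)" using N(2) by (simp add: quot_module_def)
  then have "finite {K. submodule R K M \<and> N \<subseteq> K}" by (rule finite_overmodules[OF N(1)])
  moreover have "?C \<subseteq> {K. submodule R K M \<and> N \<subseteq> K}" using K(1,2) by blast
  ultimately have "finite ?C" by (rule rev_finite_subset)
  moreover have "covering R M ?C"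
    unfolding covering_def
  proof (intro conjI ballI)
    show "submodule R L M" "L \<noteq> carrier M" if "L \<in> ?C" for L
      using that K(1) adj by blast+
    have "adjoin N x \<subseteq> carrier M" if "x \<in> carrier M" for x
      using submodule_carrier[OF K(1)[OF that]] by blast
    then show "\<Union>?C = carrier M" using K(3) by blast
  qed
  ultimately show "\<exists>C. finite C \<and> covering R M C" by blast
qed

end

section \<open>The covering number as a cardinal\<close>

lemma min_cardinal:
  assumes "K \<noteq> {}" "\<And>r. r \<in> K \<Longrightarrow> Card_order r"
  shows "min_cardinal K \<in> K" "s \<in> K \<Longrightarrow> min_cardinal K \<le>o s"
proof -
  have "\<exists>r. r \<in> K \<and> (\<forall>s\<in>K. r \<le>o s)"
    using exists_minim_Card_order[of K] assms by blast
  from someI_ex[OF this] show "min_cardinal K \<in> K" "s \<in> K \<Longrightarrow> min_cardinal K \<le>o s"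
    unfolding min_cardinal_def by blast+
qed

lemma covering_number_attained:
  assumes "covering R M C"
  obtains D where "covering R M D" "covering_number R M = |D|"
  using min_cardinal(1)[of "{|C| | C. covering R M C}"] assms card_of_Card_order
  unfolding covering_number_def by blast

lemma covering_number_le:
  assumes "covering R M C"
  shows "covering_number R M \<le>o |C|"
  using min_cardinal(2)[of "{|C| | C. covering R M C}"] assms card_of_Card_order
  unfolding covering_number_def by blast

lemma nu'_attained:
  assumes "large_fibres R M \<noteq> {}"
  obtains I where "I \<in> large_fibres R M" "nu' R M = |carrier (R Quot I)| +c cone"
  using min_cardinal(1)[of "{|carrier (R Quot I)| +c cone | I. I \<in> large_fibres R M}"]
    assms Card_order_csum unfolding nu'_def by blast

lemma nu'_le:
  assumes "I \<in> large_fibres R M"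
  shows "nu' R M \<le>o |carrier (R Quot I)| +c cone"
  using min_cardinal(2)[of "{|carrier (R Quot I)| +c cone | I. I \<in> large_fibres R M}"]
    assms Card_order_csum unfolding nu'_def by blast

theorem theorem2p2:
  fixes R :: "('a, 'c) ring_scheme" and M :: "('a, 'b, 'd) module_scheme"
  assumes "module R M"
  shows "(large_fibres R M \<noteq> {} \<longrightarrow>
      (\<exists>C. covering R M C) \<and> covering_number R M \<le>o nu' R M)
    \<and> ((\<exists>C. finite C \<and> covering R M C) \<longleftrightarrow>
      (\<exists>N. submodule R N M \<and> finite (carrier (quot_module M N))
         \<and> \<not> cyclic_module R (quot_module M N)))
    \<and> (\<forall>C. finite C \<and> covering R M C \<and> irredundant M C \<longrightarrow>
      (\<exists>N D. submodule R N M \<and> finite (carrier (quot_module M N))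
         \<and> covering R (quot_module M N) D \<and> C = lifted_covering M N D))
    \<and> ((\<exists>C. finite C \<and> covering R M C) \<longrightarrow>
      large_fibres R M \<noteq> {} \<and> covering_number R M =o nu' R M)"
proof -
  interpret module R M by (rule assms)
  have upper: "(\<exists>C. covering R M C) \<and> covering_number R M \<le>o nu' R M"
    if nonempty: "large_fibres R M \<noteq> {}"
  proof -
    obtain I where I: "I \<in> large_fibres R M" "nu' R M = |carrier (R Quot I)| +c cone"
      using nu'_attained[OF nonempty] by blast
    then obtain C where "covering R M C" "|C| \<le>o nu' R M"
      using exists_covering_by_lines by metis
    then show ?thesis using covering_number_le ordLeq_transitive by blast
  qed
  moreover have "large_fibres R M \<noteq> {} \<and> covering_number R M =o nu' R M"
    if fin: "finite C" and cov: "covering R M C" for C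
  proof -
    obtain D where D: "covering R M D" "covering_number R M = |D|"
      using covering_number_attained[OF cov] .
    then have "|D| \<le>o |C|" using covering_number_le[OF cov] by simp
    \<comment> \<open>An optimal covering is no larger than the given finite one, so the lower bound applies to it.\<close>
    then have "finite D" using fin card_of_ordLeq_finite by blast
    then obtain I where I: "I \<in> large_fibres R M" "|carrier (R Quot I)| +c cone \<le>o |D|"
      using finite_covering_bound D(1) by blast
    then have "nu' R M \<le>o covering_number R M"
      using nu'_le ordLeq_transitive unfolding D(2) by blast
    then show ?thesis using upper I(1) ordIso_iff_ordLeq by blast
  qed
  moreover have "\<exists>N D. submodule R N M \<and> finite (carrier (quot_module M N))
      \<and> covering R (quot_module M N) D \<and> C = lifted_covering M N D"
    if "finite C" "covering R M C" "irredundant M C" for C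
    using irredundant_covering_lifted[OF that] by blast
  ultimately show ?thesis
    by (intro conjI finite_covering_iff_finite_noncyclic_quotient allI impI) blast+
qed

end
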